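(* Consider the $N$-player game with decentralized Markov policies described in the context, with $\lambda_{ij}+\lambda_{ji}>0$ for at least one pair $i<j$. Suppose that there exists $p=(p_1,\dots,p_N)\in(0,\infty)^N$ such that $p_i\lambda_{ij}=p_j\lambda_{ji}$ for all $i,j\in[N]$. Assume further that $C_i(\phi)\ge0$ and $\mathcal K_{ij}(\phi)\ge0$ for all $\phi\in\Pi$, all $i\in[N]$ and all $i<j$, and that $\operatorname{SC}^{\rm opt}>0$. Then for any $\phi^p\in\arg\min_{\phi\in\Pi}\Phi^p(\phi)$, $$\operatorname{PoS}\le\operatorname{InEff}(\phi^p)\le\frac{\max_{i\in[N]}p_i}{\min_{1\le i<j\le N}\frac{p_ip_j}{p_i+p_j}}\le 2\,\frac{\max_{i\in[N]}p_i}{\min_{i\in[N]}p_i}.$$ If, in addition, $\lambda_{ij}=\lambda_{ji}$ for all $i,j\in[N]$, then $\operatorname{PoS}\le\operatorname{InEff}(\phi^{\mathbf 1})\le2$ for any $\phi^{\mathbf 1}\in\arg\min_{\phi\in\Pi}\Phi^{\mathbf 1}(\phi)$, where $\mathbf 1=(1,\dots,1)$.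
   Context: Setting. $T>0$ is a fixed horizon, $[N]=\{1,\dots,N\}$ is the set of players, and $d,k,m\in\mathbb{N}$. For each $i\in[N]$, $A_i\subset\mathbb{R}^k$ is a nonempty compact action set, and $\Pi_i\subset C([0,T]\times\mathbb{R}^d;A_i)$ is a nonempty set of admissible policies, each locally Lipschitz continuous in the spatial variable (uniformly in $t\in[0,T]$). Standing assumption: each $\Pi_i$ is compact in the compact-open topology (uniform convergence on compact subsets of $[0,T]\times\mathbb{R}^d$). Let $\Pi=\prod_{i\in[N]}\Pi_i$. Dynamics. $W$ is an $m$-dimensional Brownian motion on a complete probability space $(\Omega,\mathcal F,\mathbb P)$. For $\phi_i\in\Pi_i$, player $i$'s state $X_i^{\phi_i}$ solves $$dX_{i,t}=b_i(X_{i,t},\phi_i(t,X_{i,t}))\,dt+\sigma_i(X_{i,t},\phi_i(t,X_{i,t}))\,dW_t,\quad X_{i,0}=\xi_i,\quad t\in[0,T],$$ with $\xi_i\in\mathbb{R}^d$ given and $b_i:\mathbb{R}^d\times A_i\to\mathbb{R}^d$, $\sigma_i:\mathbb{R}^d\times A_i\to\mathbb{R}^{d\times m}$ Lipschitz continuous. Costs. For $\phi=(\phi_i)_{i\in[N]}\in\Pi$, player $i$ minimizes over $\phi_i\in\Pi_i$ $$J_i(\phi)=\mathbb{E}\left[\int_0^T\Big(f_i\big(X^{\phi_i}_{i,t},\phi_i(t,X^{\phi_i}_{i,t})\big)+\sum_{j\ne i}\lambda_{ij}K(X^{\phi_i}_{i,t}-X^{\phi_j}_{j,t})\Big)dt+g_i(X^{\phi_i}_{i,T})\right],$$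 where $\lambda_{ij}\ge 0$ are constants, $f_i:\mathbb{R}^d\times A_i\to\mathbb{R}$ and $g_i:\mathbb{R}^d\to\mathbb{R}$ are continuous with at most quadratic growth, and $K:\mathbb{R}^d\to\mathbb{R}$ is bounded and continuous with $K(x)=K(-x)$ for all $x$ and $K\not\equiv0$. Cost components. $$C_i(\phi):=\mathbb{E}\left[\int_0^T f_i\big(X^{\phi_i}_{i,t},\phi_i(t,X^{\phi_i}_{i,t})\big)dt+g_i(X^{\phi_i}_{i,T})\right],\qquad \mathcal K_{ij}(\phi):=\mathbb{E}\left[\int_0^T K\big(X^{\phi_i}_{i,t}-X^{\phi_j}_{j,t}\big)dt\right].$$ Rescaled potential. For $p\in(0,\infty)^N$, $$\Phi^p(\phi):=\sum_{i=1}^N p_iC_i(\phi)+\frac12\sum_{1\le i<j\le N}(p_i\lambda_{ij}+p_j\lambda_{ji})\mathcal K_{ij}(\phi),\qquad \phi\in\Pi.$$ Social cost, inefficiency, price of stability. $\operatorname{SC}(\phi):=\sum_{i=1}^N J_i(\phi)$, $\operatorname{SC}^{\rm opt}:=\inf_{\phi\in\Pi}\operatorname{SC}(\phi)$, $\operatorname{InEff}(\phi):=\operatorname{SC}(\phi)/\operatorname{SC}^{\rm opt}$. A Nash equilibrium is $\bar\phi\in\Pi$ with $J_i(\bar\phi)\le J_i(\phi_i,\bar\phi_{-i})$ for all $\phi_i\in\Pi_i$, $i\in[N]$; with $\mathcal E$ the set of Nash equilibria, $\operatorname{PoS}:=\inf_{\phi\in\mathcal E}\operatorname{SC}(\phi)/\operatorname{SC}^{\rm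 opt}=\inf_{\phi\in\mathcal E}\operatorname{InEff}(\phi)$. *)

theory Defs
  imports "HOL-Probability.Probability"
begin

section \<open>Brownian motion and the Ito integral\<close>

text \<open>The filtration generated by a process, and its augmentation by the null sets of the
  underlying probability space.\<close>

definition natural_filtration ::
  "'w measure \<Rightarrow> (real \<Rightarrow> 'w \<Rightarrow> 'b::topological_space) \<Rightarrow> real \<Rightarrow> 'w measure" where
  "natural_filtration M W t =
     sigma (space M) {W s -` B \<inter> space M | s B. 0 \<le> s \<and> s \<le> t \<and> B \<in> sets borel}"

definition augmented_filtration ::
  "'w measure \<Rightarrow> (real \<Rightarrow> 'w \<Rightarrow> 'b::topological_space) \<Rightarrow> real \<Rightarrow> 'w measure" where
  "augmented_filtration M W t =
     sigma (space M) (sets (natural_filtration M W t) \<union> null_sets M)"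

definition brownian_motion :: "'w measure \<Rightarrow> (real \<Rightarrow> 'w \<Rightarrow> real^'m) \<Rightarrow> bool" where
  "brownian_motion M W \<longleftrightarrow>
     prob_space M \<and>
     (\<forall>t\<ge>0. W t \<in> borel_measurable M) \<and>
     (AE \<omega> in M. W 0 \<omega> = 0) \<and>
     (AE \<omega> in M. continuous_on {0..} (\<lambda>t. W t \<omega>)) \<and>
     (\<forall>s t. 0 \<le> s \<and> s < t \<longrightarrow>
        prob_space.indep_set M
          (sets (vimage_algebra (space M) (\<lambda>\<omega>. W t \<omega> - W s \<omega>) borel))
          (sets (natural_filtration M W s)) \<and>
        prob_space.indep_vars M (\<lambda>_. borel) (\<lambda>j \<omega>. (W t \<omega> - W s \<omega>) $ j) UNIV \<and>
        (\<forall>j. distributed M lborel (\<lambda>\<omega>. (W t \<omega> - W s \<omega>) $ j)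
               (\<lambda>x. ennreal (normal_density 0 (sqrt (t - s)) x))))"

text \<open>A simple integrand on \<open>[0,t]\<close> is given by \<open>n\<close>, grid points
  \<open>0 \<le> \<tau> 0 \<le> \<dots> \<le> \<tau> n \<le> t\<close> and bounded random matrices \<open>\<eta> k\<close>, known at time
  \<open>\<tau> k\<close>; it takes the value \<open>\<eta> k\<close> on the half-open interval from \<open>\<tau> k\<close> (excluded) to
  \<open>\<tau> (k + 1)\<close> (included).\<close>

definition simple_integrand ::
  "'w measure \<Rightarrow> (real \<Rightarrow> 'w measure) \<Rightarrow> real \<Rightarrow>
   nat \<Rightarrow> (nat \<Rightarrow> real) \<Rightarrow> (nat \<Rightarrow> 'w \<Rightarrow> real^'m^'d) \<Rightarrow> bool" where
  "simple_integrand M F t n \<tau> \<eta> \<longleftrightarrow>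
     0 \<le> \<tau> 0 \<and> (\<forall>k<n. \<tau> k \<le> \<tau> (Suc k)) \<and> \<tau> n \<le> t \<and>
     (\<forall>k<n. \<eta> k \<in> borel_measurable (F (\<tau> k))) \<and>
     (\<exists>c. \<forall>k<n. \<forall>\<omega>\<in>space M. norm (\<eta> k \<omega>) \<le> c)"

definition simple_value ::
  "nat \<Rightarrow> (nat \<Rightarrow> real) \<Rightarrow> (nat \<Rightarrow> 'w \<Rightarrow> real^'m^'d) \<Rightarrow> real \<Rightarrow> 'w \<Rightarrow> real^'m^'d" where
  "simple_value n \<tau> \<eta> s \<omega> = (\<Sum>k<n. indicator {\<tau> k<..\<tau> (Suc k)} s *\<^sub>R \<eta> k \<omega>)"

definition simple_integral ::
  "(real \<Rightarrow> 'w \<Rightarrow> real^'m) \<Rightarrow> nat \<Rightarrow> (nat \<Rightarrow> real) \<Rightarrow> (nat \<Rightarrow> 'w \<Rightarrow> real^'m^'d) \<Rightarrow> 'w \<Rightarrow> real^'d"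
where
  "simple_integral W n \<tau> \<eta> \<omega> = (\<Sum>k<n. \<eta> k \<omega> *v (W (\<tau> (Suc k)) \<omega> - W (\<tau> k) \<omega>))"

text \<open>\<open>L2_integrand M F t H\<close>: the process \<open>H\<close> is progressively measurable and
  square-integrable over \<open>[0,t] \<times> \<Omega>\<close>. The norm on \<^typ>\<open>real^'m^'d\<close> is the Frobenius
  norm.\<close>

definition L2_integrand ::
  "'w measure \<Rightarrow> (real \<Rightarrow> 'w measure) \<Rightarrow> real \<Rightarrow> (real \<Rightarrow> 'w \<Rightarrow> real^'m^'d) \<Rightarrow> bool" where
  "L2_integrand M F t H \<longleftrightarrow>
     (\<forall>u\<in>{0..t}. (\<lambda>(s, \<omega>). H s \<omega>) \<in>
        borel_measurable (restrict_space borel {0..u} \<Otimes>\<^sub>M F u)) \<and>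
     (\<integral>\<^sup>+\<omega>. (\<integral>\<^sup>+s\<in>{0..t}. ennreal ((norm (H s \<omega>))\<^sup>2) \<partial>lborel) \<partial>M) < \<infinity>"

text \<open>\<open>has_ito_integral M F W t H I\<close> says that the random vector \<open>I\<close> is (a version of) the
  integral of \<open>H\<close> against \<open>W\<close> over \<open>[0,t]\<close>, i.e. the limit in \<open>L\<^sup>2\<close> of the integrals of simple
  integrands which converge to \<open>H\<close> in \<open>L\<^sup>2([0,t] \<times> \<Omega>)\<close>.\<close>

definition has_ito_integral ::
  "'w measure \<Rightarrow> (real \<Rightarrow> 'w measure) \<Rightarrow> (real \<Rightarrow> 'w \<Rightarrow> real^'m) \<Rightarrow> real \<Rightarrow>
   (real \<Rightarrow> 'w \<Rightarrow> real^'m^'d) \<Rightarrow> ('w \<Rightarrow> real^'d) \<Rightarrow> bool" where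
  "has_ito_integral M F W t H I \<longleftrightarrow>
     L2_integrand M F t H \<and> I \<in> borel_measurable M \<and>
     (\<exists>n \<tau> \<eta>.
        (\<forall>l. simple_integrand M F t (n l) (\<tau> l) (\<eta> l)) \<and>
        (\<lambda>l. \<integral>\<^sup>+\<omega>. (\<integral>\<^sup>+s\<in>{0..t}.
            ennreal ((norm (simple_value (n l) (\<tau> l) (\<eta> l) s \<omega> - H s \<omega>))\<^sup>2) \<partial>lborel) \<partial>M)
          \<longlonglongrightarrow> 0 \<and>
        (\<lambda>l. \<integral>\<^sup>+\<omega>. ennreal ((norm (simple_integral W (n l) (\<tau> l) (\<eta> l) \<omega> - I \<omega>))\<^sup>2) \<partial>M)
          \<longlonglongrightarrow> 0)"

text \<open>Strong solutions on \<open>[0,T]\<close> of \<open>dX = \<beta>(t, X) dt + \<gamma>(t, X) dW\<close>, \<open>X\<^sub>0 = \<xi>\<close>: continuous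
  processes adapted to the augmented filtration of \<open>W\<close> that satisfy the integral equation. The
  drift integral needs no extra condition, as \<open>\<beta>(s, X\<^sub>s)\<close> is continuous in \<open>s\<close> for the
  coefficients used below.\<close>

definition sde_solution ::
  "'w measure \<Rightarrow> (real \<Rightarrow> 'w \<Rightarrow> real^'m) \<Rightarrow> real \<Rightarrow> real^'d \<Rightarrow>
   (real \<Rightarrow> real^'d \<Rightarrow> real^'d) \<Rightarrow> (real \<Rightarrow> real^'d \<Rightarrow> real^'m^'d) \<Rightarrow>
   (real \<Rightarrow> 'w \<Rightarrow> real^'d) \<Rightarrow> bool" where
  "sde_solution M W T \<xi> \<beta> \<gamma> X \<longleftrightarrow>
     (\<forall>t\<in>{0..T}. X t \<in> borel_measurable (augmented_filtration M W t)) \<and>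
     (\<forall>\<omega>\<in>space M. continuous_on {0..T} (\<lambda>t. X t \<omega>)) \<and>
     (\<forall>t\<in>{0..T}. \<exists>I.
        has_ito_integral M (augmented_filtration M W) W t (\<lambda>s \<omega>. \<gamma> s (X s \<omega>)) I \<and>
        (AE \<omega> in M. X t \<omega> = \<xi> + (LINT s:{0..t}|lborel. \<beta> s (X s \<omega>)) + I \<omega>))"


section \<open>The compact-open topology\<close>

definition compact_open_topology ::
  "'a::topological_space set \<Rightarrow> ('a \<Rightarrow> 'b::topological_space) topology" where
  "compact_open_topology S = topology_generated_by
     {{f \<in> extensional S. continuous_on S f \<and> f ` C \<subseteq> U} | C U.
        compact C \<and> C \<subseteq> S \<and> open U}"


section \<open>The game\<close>

text \<open>A policy is a function of \<open>(t, x)\<close>; only its values on \<open>[0,T] \<times> \<real>\<^sup>d\<close> matter, so policies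
  are \<^const>\<open>extensional\<close> there.\<close>

type_synonym ('d, 'k) policy = "real \<times> (real^'d) \<Rightarrow> real^'k"

record ('w, 'd::finite, 'k::finite, 'm::finite) game =
  base :: "'w measure"
  noise :: "real \<Rightarrow> 'w \<Rightarrow> real^'m"
  horizon :: real
  nplayers :: nat
  actions :: "nat \<Rightarrow> (real^'k) set"
  policies :: "nat \<Rightarrow> ('d, 'k) policy set"
  init :: "nat \<Rightarrow> real^'d"
  drift :: "nat \<Rightarrow> real^'d \<Rightarrow> real^'k \<Rightarrow> real^'d"
  diffusion :: "nat \<Rightarrow> real^'d \<Rightarrow> real^'k \<Rightarrow> real^'m^'d"
  running_cost :: "nat \<Rightarrow> real^'d \<Rightarrow> real^'k \<Rightarrow> real"
  terminal_cost :: "nat \<Rightarrow> real^'d \<Rightarrow> real"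
  weight :: "nat \<Rightarrow> nat \<Rightarrow> real"
  kernel :: "real^'d \<Rightarrow> real"

definition players :: "('w, 'd::finite, 'k::finite, 'm::finite) game \<Rightarrow> nat set" where
  "players G = {1..nplayers G}"

definition time_space :: "('w, 'd::finite, 'k::finite, 'm::finite) game \<Rightarrow> (real \<times> (real^'d)) set" where
  "time_space G = {0..horizon G} \<times> UNIV"

definition admissible_policies :: "('w, 'd::finite, 'k::finite, 'm::finite) game \<Rightarrow> nat \<Rightarrow> bool" where
  "admissible_policies G i \<longleftrightarrow>
     policies G i \<noteq> {} \<and>
     compactin (compact_open_topology (time_space G)) (policies G i) \<and>
     (\<forall>\<psi>\<in>policies G i.
        \<psi> \<in> extensional (time_space G) \<and> continuous_on (time_space G) \<psi> \<and>
        \<psi> ` time_space G \<subseteq> actions G i \<and>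
        (\<forall>x. \<exists>r>0. \<exists>L. \<forall>t\<in>{0..horizon G}. L-lipschitz_on (cball x r) (\<lambda>y. \<psi> (t, y))))"

definition markov_game :: "('w, 'd::finite, 'k::finite, 'm::finite) game \<Rightarrow> bool" where
  "markov_game G \<longleftrightarrow>
     prob_space (base G) \<and> complete_measure (base G) \<and>
     brownian_motion (base G) (noise G) \<and>
     horizon G > 0 \<and>
     (\<forall>i\<in>players G.
        actions G i \<noteq> {} \<and> compact (actions G i) \<and>
        admissible_policies G i \<and>
        (\<exists>L. L-lipschitz_on (UNIV \<times> actions G i) (\<lambda>(x, a). drift G i x a)) \<and>
        (\<exists>L. L-lipschitz_on (UNIV \<times> actions G i) (\<lambda>(x, a). diffusion G i x a)) \<and>
        continuous_on (UNIV \<times> actions G i) (\<lambda>(x, a). running_cost G i x a) \<and>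
        (\<exists>c. \<forall>x. \<forall>a\<in>actions G i. \<bar>running_cost G i x a\<bar> \<le> c * (1 + (norm x)\<^sup>2)) \<and>
        continuous_on UNIV (terminal_cost G i) \<and>
        (\<exists>c. \<forall>x. \<bar>terminal_cost G i x\<bar> \<le> c * (1 + (norm x)\<^sup>2)) \<and>
        (\<forall>j\<in>players G. i \<noteq> j \<longrightarrow> 0 \<le> weight G i j)) \<and>
     continuous_on UNIV (kernel G) \<and> bounded (range (kernel G)) \<and>
     (\<forall>x. kernel G (- x) = kernel G x) \<and> (\<exists>x. kernel G x \<noteq> 0)"

text \<open>\<open>X i \<psi>\<close> is the state process of player \<open>i\<close> when using policy \<open>\<psi>\<close>. Under the standing
  assumptions it is determined up to indistinguishability, so that the choice of \<open>X\<close> affects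
  none of the quantities below.\<close>

type_synonym ('w, 'd, 'k) states = "nat \<Rightarrow> ('d, 'k) policy \<Rightarrow> real \<Rightarrow> 'w \<Rightarrow> real^'d"

definition state_processes ::
  "('w, 'd::finite, 'k::finite, 'm::finite) game \<Rightarrow> ('w, 'd, 'k) states \<Rightarrow> bool" where
  "state_processes G X \<longleftrightarrow>
     (\<forall>i\<in>players G. \<forall>\<psi>\<in>policies G i.
        sde_solution (base G) (noise G) (horizon G) (init G i)
          (\<lambda>t x. drift G i x (\<psi> (t, x))) (\<lambda>t x. diffusion G i x (\<psi> (t, x))) (X i \<psi>))"

definition profiles :: "('w, 'd::finite, 'k::finite, 'm::finite) game \<Rightarrow> (nat \<Rightarrow> ('d, 'k) policy) set" where
  "profiles G = (\<Pi>\<^sub>E i\<in>players G. policies G i)"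

definition cost ::
  "('w, 'd::finite, 'k::finite, 'm::finite) game \<Rightarrow> ('w, 'd, 'k) states \<Rightarrow> nat \<Rightarrow>
   (nat \<Rightarrow> ('d, 'k) policy) \<Rightarrow> real" where
  "cost G X i \<phi> =
     (\<integral>\<omega>. (LINT t:{0..horizon G}|lborel.
              running_cost G i (X i (\<phi> i) t \<omega>) (\<phi> i (t, X i (\<phi> i) t \<omega>))
              + (\<Sum>j\<in>players G - {i}.
                   weight G i j * kernel G (X i (\<phi> i) t \<omega> - X j (\<phi> j) t \<omega>)))
          + terminal_cost G i (X i (\<phi> i) (horizon G) \<omega>) \<partial>base G)"

definition own_cost ::
  "('w, 'd::finite, 'k::finite, 'm::finite) game \<Rightarrow> ('w, 'd, 'k) states \<Rightarrow> nat \<Rightarrow>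
   (nat \<Rightarrow> ('d, 'k) policy) \<Rightarrow> real" where
  "own_cost G X i \<phi> =
     (\<integral>\<omega>. (LINT t:{0..horizon G}|lborel.
              running_cost G i (X i (\<phi> i) t \<omega>) (\<phi> i (t, X i (\<phi> i) t \<omega>)))
          + terminal_cost G i (X i (\<phi> i) (horizon G) \<omega>) \<partial>base G)"

definition interaction ::
  "('w, 'd::finite, 'k::finite, 'm::finite) game \<Rightarrow> ('w, 'd, 'k) states \<Rightarrow> nat \<Rightarrow> nat \<Rightarrow>
   (nat \<Rightarrow> ('d, 'k) policy) \<Rightarrow> real" where
  "interaction G X i j \<phi> =
     (\<integral>\<omega>. (LINT t:{0..horizon G}|lborel.
              kernel G (X i (\<phi> i) t \<omega> - X j (\<phi> j) t \<omega>)) \<partial>base G)"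

definition rescaled_potential ::
  "('w, 'd::finite, 'k::finite, 'm::finite) game \<Rightarrow> ('w, 'd, 'k) states \<Rightarrow> (nat \<Rightarrow> real) \<Rightarrow>
   (nat \<Rightarrow> ('d, 'k) policy) \<Rightarrow> real" where
  "rescaled_potential G X p \<phi> =
     (\<Sum>i\<in>players G. p i * own_cost G X i \<phi>)
     + 1/2 * (\<Sum>(i, j)\<in>{(i, j). 1 \<le> i \<and> i < j \<and> j \<le> nplayers G}.
                (p i * weight G i j + p j * weight G j i) * interaction G X i j \<phi>)"

definition nash_equilibria ::
  "('w, 'd::finite, 'k::finite, 'm::finite) game \<Rightarrow> ('w, 'd, 'k) states \<Rightarrow>
   (nat \<Rightarrow> ('d, 'k) policy) set" where
  "nash_equilibria G X =
     {\<phi> \<in> profiles G. \<forall>i\<in>players G. \<forall>\<psi>\<in>policies G i.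
        cost G X i \<phi> \<le> cost G X i (\<phi>(i := \<psi>))}"

definition social_cost ::
  "('w, 'd::finite, 'k::finite, 'm::finite) game \<Rightarrow> ('w, 'd, 'k) states \<Rightarrow>
   (nat \<Rightarrow> ('d, 'k) policy) \<Rightarrow> real" where
  "social_cost G X \<phi> = (\<Sum>i\<in>players G. cost G X i \<phi>)"

text \<open>The infima below are taken in \<^typ>\<open>real\<close>, hence meaningful only over nonempty sets on
  which the social cost is bounded below.\<close>

definition social_opt ::
  "('w, 'd::finite, 'k::finite, 'm::finite) game \<Rightarrow> ('w, 'd, 'k) states \<Rightarrow> real" where
  "social_opt G X = (INF \<phi>\<in>profiles G. social_cost G X \<phi>)"

definition inefficiency ::
  "('w, 'd::finite, 'k::finite, 'm::finite) game \<Rightarrow> ('w, 'd, 'k) states \<Rightarrow>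
   (nat \<Rightarrow> ('d, 'k) policy) \<Rightarrow> real" where
  "inefficiency G X \<phi> = social_cost G X \<phi> / social_opt G X"

definition price_of_stability ::
  "('w, 'd::finite, 'k::finite, 'm::finite) game \<Rightarrow> ('w, 'd, 'k) states \<Rightarrow> real" where
  "price_of_stability G X = (INF \<phi>\<in>nash_equilibria G X. inefficiency G X \<phi>)"

end

theory Submission
  imports Defs
begin

text \<open>The costs are Bochner integrals, which are zero for non-integrable functions, so splitting
  player \<open>i\<close>'s cost into \<open>C\<^sub>i + \<Sum>\<^sub>j \<lambda>\<^sub>i\<^sub>j K\<^sub>i\<^sub>j\<close> requires second moments of the states. These come
  from the \<open>L\<^sup>2\<close> bound for the Ito integral, the linear growth of the drift and a pathwise
  Gronwall argument.

  By the balance condition, a unilateral deviation of player \<open>i\<close> changes \<open>\<Phi>\<^sup>p\<close> by \<open>p\<^sub>i\<close> times the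
  change of \<open>J\<^sub>i\<close>, so minimizers of \<open>\<Phi>\<^sup>p\<close> are Nash equilibria. The same condition turns the
  coefficient of \<open>K\<^sub>i\<^sub>j\<close> in \<open>\<Phi>\<^sup>p\<close> into \<open>p\<^sub>i p\<^sub>j / (p\<^sub>i + p\<^sub>j)\<close> times its coefficient in the social
  cost. Since \<open>p\<^sub>i p\<^sub>j / (p\<^sub>i + p\<^sub>j) \<le> p\<^sub>i\<close>, the potential lies between \<open>min p\<^sub>i p\<^sub>j / (p\<^sub>i + p\<^sub>j)\<close> and
  \<open>max p\<^sub>i\<close> times the social cost, and comparing a minimizer of \<open>\<Phi>\<^sup>p\<close> with an arbitrary profile
  gives the bound.\<close>

section \<open>Continuous processes and Gronwall's inequality\<close>

text \<open>The integral equation of a solution holds at each time only off a null set that may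
  depend on the time, and its Ito term comes as a separate random vector for every time. No common
  inhomogeneous term is therefore available along a path. This is why the pathwise inequality is
  stated for an arbitrary continuous function in terms of its own defect, and why the defect is
  estimated in expectation, one time at a time. The diffusion enters as a constant: square
  integrability of the diffusion coefficient along the state is part of what it means for its Ito
  integral to exist. Only finiteness matters afterwards, so a one-sided estimate with a crude
  constant replaces the Ito isometry. Independence of increments is known for the natural
  filtration, whereas solutions and integrands live on the augmented one; the passage between them
  needs an argument of its own. The coefficient identity comes from the common value \<open>s =
  p\<^sub>i \<lambda>\<^sub>i\<^sub>j = p\<^sub>j \<lambda>\<^sub>j\<^sub>i\<close>: then
  \<open>\<lambda>\<^sub>i\<^sub>j + \<lambda>\<^sub>j\<^sub>i = s (1/p\<^sub>i +
  1/p\<^sub>j)\<close>, while \<open>s\<close> itself is the coefficient in the potential.\<close>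

lemma borel_measurable_pair_continuous_paths:
  fixes Y :: "real \<Rightarrow> 'w \<Rightarrow> 'b::{banach, second_countable_topology}"
  assumes meas: "\<And>t. t \<in> {0..T} \<Longrightarrow> Y t \<in> borel_measurable M"
    and cont: "\<And>\<omega>. \<omega> \<in> space M \<Longrightarrow> continuous_on {0..T} (\<lambda>t. Y t \<omega>)"
  shows "(\<lambda>(\<omega>, t). indicator {0..T} t *\<^sub>R Y t \<omega>) \<in> borel_measurable (M \<Otimes>\<^sub>M lborel)"
proof (cases "0 \<le> T")
  case False
  then show ?thesis by simp
next
  case True
  define c where "c x = max 0 (min T x)" for x :: real
  \<comment> \<open>\<open>g n t\<close> rounds \<open>t\<close> down to the grid of mesh
    \<open>1 / (n + 1)\<close> and clamps the result into \<open>[0, T]\<close>, where alone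
    \<open>Y\<close> is known to be measurable. Only countably many grid points occur, which gives
    joint measurability; continuity of the paths takes care of the limit.\<close>
  define g where "g n t = c (of_int \<lfloor>t * real (Suc n)\<rfloor> / real (Suc n))" for n :: nat and t
  have c_in: "c x \<in> {0..T}" for x
    using True by (auto simp: c_def)
  have meas_g: "(\<lambda>z. Y (g n (snd z)) (fst z)) \<in> borel_measurable (M \<Otimes>\<^sub>M lborel)" for n
  proof -
    have *: "(\<lambda>z. Y (c (of_int i / real (Suc n))) (fst z)) \<in> borel_measurable (M \<Otimes>\<^sub>M lborel)"
      for i :: int
      by (rule measurable_compose[OF measurable_fst meas[OF c_in]])
    show ?thesis
      unfolding g_def by (rule measurable_compose_countable[OF *]) measurable
  qed
  have lim_g: "(\<lambda>n. g n t) \<longlonglongrightarrow> t" if "t \<in> {0..T}" for t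
  proof -
    have "(\<lambda>n. of_int \<lfloor>t * real (Suc n)\<rfloor> / real (Suc n)) \<longlonglongrightarrow> t"
    proof (rule tendsto_sandwich)
      have "t - 1 / real (Suc n) \<le> of_int \<lfloor>t * real (Suc n)\<rfloor> / real (Suc n)" for n
      proof -
        have "(t - 1 / real (Suc n)) * real (Suc n) \<le> of_int \<lfloor>t * real (Suc n)\<rfloor>"
          using real_of_int_floor_add_one_ge[of "t * real (Suc n)"]
          by (simp add: left_diff_distrib del: of_nat_Suc)
        then show ?thesis by (simp add: pos_le_divide_eq del: of_nat_Suc)
      qed
      then show "\<forall>\<^sub>F n in sequentially.
          t - 1 / real (Suc n) \<le> of_int \<lfloor>t * real (Suc n)\<rfloor> / real (Suc n)" by simp
      have "of_int \<lfloor>t * real (Suc n)\<rfloor> / real (Suc n) \<le> t" for n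
        by (simp add: pos_divide_le_eq del: of_nat_Suc)
      then show "\<forall>\<^sub>F n in sequentially. of_int \<lfloor>t * real (Suc n)\<rfloor> / real (Suc n) \<le> t" by simp
      show "(\<lambda>n. t - 1 / real (Suc n)) \<longlonglongrightarrow> t"
        using tendsto_diff[OF tendsto_const LIMSEQ_inverse_real_of_nat, of t]
        by (simp add: inverse_eq_divide)
    qed simp
    then have "(\<lambda>n. g n t) \<longlonglongrightarrow> c t"
      unfolding g_def c_def by (intro tendsto_max tendsto_min tendsto_const)
    then show ?thesis using that by (simp add: c_def)
  qed
  show ?thesis
  proof (rule borel_measurable_LIMSEQ_metric)
    show "(\<lambda>z. indicator {0..T} (snd z) *\<^sub>R Y (g n (snd z)) (fst z))
        \<in> borel_measurable (M \<Otimes>\<^sub>M lborel)" for n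
      using meas_g[of n] by measurable
  next
    fix z assume z: "z \<in> space (M \<Otimes>\<^sub>M (lborel :: real measure))"
    obtain \<omega> t where [simp]: "z = (\<omega>, t)" by (cases z)
    have "\<omega> \<in> space M" using z by (simp add: space_pair_measure)
    have "(\<lambda>n. Y (g n t) \<omega>) \<longlonglongrightarrow> Y t \<omega>" if "t \<in> {0..T}"
      by (rule continuous_on_tendsto_compose[OF cont[OF \<open>\<omega> \<in> space M\<close>] lim_g[OF that] that])
        (simp add: g_def c_in del: atLeastAtMost_iff)
    then show "(\<lambda>n. indicator {0..T} (snd z) *\<^sub>R Y (g n (snd z)) (fst z))
        \<longlonglongrightarrow> (case z of (\<omega>, t) \<Rightarrow> indicator {0..T} t *\<^sub>R Y t \<omega>)"
      by (auto simp: indicator_def)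
  qed
qed

lemma borel_measurable_time_integral:
  fixes Y :: "real \<Rightarrow> 'w \<Rightarrow> 'b::{banach, second_countable_topology}"
  assumes "\<And>t. t \<in> {0..T} \<Longrightarrow> Y t \<in> borel_measurable M"
    and "\<And>\<omega>. \<omega> \<in> space M \<Longrightarrow> continuous_on {0..T} (\<lambda>t. Y t \<omega>)"
  shows "(\<lambda>\<omega>. LINT t:{0..T}|lborel. Y t \<omega>) \<in> borel_measurable M"
  unfolding set_lebesgue_integral_def
  by (rule lborel.borel_measurable_lebesgue_integral)
    (use borel_measurable_pair_continuous_paths[OF assms] in simp)

text \<open>A bridge between two integrals: the costs use the Lebesgue integral, whereas the
  calculus below (differentiating an indefinite integral, norm bounds) is carried out with the gauge
  integral.\<close>

lemma LINT_eq_integral: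
  fixes f :: "real \<Rightarrow> 'b::euclidean_space"
  assumes "continuous_on {a..b} f"
  shows "(LINT t:{a..b}|lborel. f t) = integral {a..b} f"
  by (rule set_borel_integral_eq_integral) (rule borel_integrable_atLeastAtMost', fact)

text \<open>Every \<open>h\<close> satisfies \<open>h \<le> r + b * U\<close>, where
  \<open>U\<close> is its indefinite integral and \<open>r\<close> the positive part of
  \<open>h - b * U\<close>. Taking \<open>r\<close> as the inhomogeneous term makes the inequality
  hold on every path, with no estimate of \<open>h\<close> as a premise.\<close>

lemma gronwall_integral:
  fixes h :: "real \<Rightarrow> real"
  assumes cont: "continuous_on {0..T} h" and "0 \<le> T" "0 \<le> b"
  shows "integral {0..T} h
    \<le> exp (b * T) * integral {0..T} (\<lambda>t. max 0 (h t - b * integral {0..t} h))"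
proof -
  define U where "U t = integral {0..t} h" for t
  define r where "r t = max 0 (h t - b * U t)" for t
  have dU: "(U has_vector_derivative h t) (at t within {0..T})" if "t \<in> {0..T}" for t
    unfolding U_def by (rule integral_has_vector_derivative[OF cont that])
  have "continuous_on {0..T} U"
    unfolding U_def
    by (rule indefinite_integral_continuous_1[OF integrable_continuous_real[OF cont]])
  then have cr: "continuous_on {0..T} r"
    unfolding r_def by (intro continuous_intros cont)
  \<comment> \<open>The integrating factor: \<open>V\<close> is nonincreasing because
    \<open>r\<close> dominates \<open>h - b * U\<close>, is nonnegative, and is multiplied by
    \<open>exp (- b * t) \<le> 1\<close>.\<close>
  define V where "V t = exp (- b * t) * U t - integral {0..t} r" for t
  have dV: "(V has_real_derivative exp (- b * t) * h t - b * exp (- b * t) * U t - r t)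
      (at t within {0..T})" if "t \<in> {0..T}" for t
  proof -
    have [derivative_intros]: "(U has_real_derivative h t) (at t within {0..T})"
      using dU[OF that] by (simp add: has_real_derivative_iff_has_vector_derivative)
    have [derivative_intros]:
      "((\<lambda>t. integral {0..t} r) has_real_derivative r t) (at t within {0..T})"
      using integral_has_vector_derivative[OF cr that]
      by (simp add: has_real_derivative_iff_has_vector_derivative)
    show ?thesis
      unfolding V_def by (auto intro!: derivative_eq_intros simp: algebra_simps)
  qed
  have nonpos: "exp (- b * t) * h t - b * exp (- b * t) * U t - r t \<le> 0" if "t \<in> {0..T}" for t
  proof -
    have "exp (- b * t) * h t - b * exp (- b * t) * U t = exp (- b * t) * (h t - b * U t)"
      by (simp add: algebra_simps)
    also have "\<dots> \<le> exp (- b * t) * r t"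
      by (intro mult_left_mono) (auto simp: r_def)
    also have "\<dots> \<le> 1 * r t"
      using that \<open>0 \<le> b\<close> by (intro mult_right_mono) (auto simp: r_def)
    finally show ?thesis by simp
  qed
  have "V T \<le> V 0"
  proof (rule DERIV_nonpos_imp_decreasing_open[OF \<open>0 \<le> T\<close>])
    show "\<exists>y. (V has_real_derivative y) (at t) \<and> y \<le> 0" if "0 < t" "t < T" for t
    proof -
      have "t \<in> {0..T}" using that by simp
      then show ?thesis using dV nonpos that at_within_Icc_at[of 0 t T] by metis
    qed
    show "continuous_on {0..T} V"
      using dV by (rule DERIV_continuous_on)
  qed
  then have "exp (- b * T) * U T \<le> integral {0..T} r"
    by (simp add: V_def U_def)
  then have "exp (b * T) * (exp (- b * T) * U T) \<le> exp (b * T) * integral {0..T} r"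
    by (intro mult_left_mono) auto
  then show ?thesis
    by (simp add: mult.assoc[symmetric] exp_add[symmetric] U_def r_def[abs_def])
qed

text \<open>Cauchy-Schwarz against the constant 1, read off from the nonnegativity of the variance
  of \<open>h\<close> around its mean \<open>m\<close>.\<close>

lemma integral_square_le:
  fixes h :: "real \<Rightarrow> real"
  assumes cont: "continuous_on {0..t} h" and "0 \<le> t"
  shows "(integral {0..t} h)\<^sup>2 \<le> t * integral {0..t} (\<lambda>s. (h s)\<^sup>2)"
proof (cases "t = 0")
  case False
  define m where "m = integral {0..t} h / t"
  have "0 \<le> integral {0..t} (\<lambda>s. (h s - m)\<^sup>2)"
    by (rule integral_nonneg) (auto intro!: integrable_continuous_real continuous_intros cont)
  also have "\<dots> = integral {0..t} (\<lambda>s. (h s)\<^sup>2 - (2 * m) * h s + m\<^sup>2)"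
    by (simp add: power2_diff algebra_simps)
  also have "\<dots> = integral {0..t} (\<lambda>s. (h s)\<^sup>2) - (2 * m) * integral {0..t} h + t * m\<^sup>2"
    (is "_ = ?R")
  proof (rule integral_unique)
    have "((\<lambda>s. (h s)\<^sup>2 - (2 * m) * h s + m\<^sup>2) has_integral
        integral {0..t} (\<lambda>s. (h s)\<^sup>2) - (2 * m) * integral {0..t} h + (t - 0) *\<^sub>R m\<^sup>2) {0..t}"
      using has_integral_const_real[of "m\<^sup>2" 0 t] \<open>0 \<le> t\<close>
      by (intro has_integral_add has_integral_diff has_integral_mult_right integrable_integral
          integrable_continuous_real continuous_intros cont) simp_all
    then show "((\<lambda>s. (h s)\<^sup>2 - (2 * m) * h s + m\<^sup>2) has_integral ?R) {0..t}" by simp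
  qed
  also have "\<dots> = integral {0..t} (\<lambda>s. (h s)\<^sup>2) - (integral {0..t} h)\<^sup>2 / t"
    using False by (simp add: m_def field_simps power2_eq_square)
  finally show ?thesis
    using False \<open>0 \<le> t\<close> by (simp add: field_simps)
qed simp

text \<open>The process \<open>h\<close> need not be integrable a priori: Gronwall is applied on each path, to the
  positive part of \<open>h - b \<integral> h\<close>, and the expectation of that part is bounded by Tonelli.\<close>

lemma gronwall_expectation:
  fixes h :: "real \<Rightarrow> 'w \<Rightarrow> real"
  assumes "sigma_finite_measure M" and "0 \<le> T" and "0 \<le> b"
    and meas: "\<And>t. t \<in> {0..T} \<Longrightarrow> h t \<in> borel_measurable M"
    and cont: "\<And>\<omega>. \<omega> \<in> space M \<Longrightarrow> continuous_on {0..T} (\<lambda>t. h t \<omega>)"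
    and nonneg: "\<And>t \<omega>. 0 \<le> h t \<omega>"
    and bound: "\<And>t. t \<in> {0..T} \<Longrightarrow> \<exists>Z. (\<forall>\<omega>. 0 \<le> Z \<omega>) \<and>
      (AE \<omega> in M. h t \<omega> \<le> Z \<omega> + b * (LINT s:{0..t}|lborel. h s \<omega>)) \<and>
      (\<integral>\<^sup>+\<omega>. ennreal (Z \<omega>) \<partial>M) \<le> ennreal C"
  shows "integrable M (\<lambda>\<omega>. LINT t:{0..T}|lborel. h t \<omega>)"
proof -
  interpret sigma_finite_measure M by fact
  interpret pair_sigma_finite M lborel ..
  define r where "r t \<omega> = max 0 (h t \<omega> - b * (LINT s:{0..t}|lborel. h s \<omega>))" for t \<omega>
  have LINT: "(LINT s:{0..t}|lborel. h s \<omega>) = integral {0..t} (\<lambda>s. h s \<omega>)"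
    if "\<omega> \<in> space M" "t \<in> {0..T}" for t \<omega>
    using that by (intro LINT_eq_integral continuous_on_subset[OF cont]) auto
  have meas_int: "(\<lambda>\<omega>. LINT s:{0..t}|lborel. h s \<omega>) \<in> borel_measurable M" if "t \<in> {0..T}" for t
    using that
    by (intro borel_measurable_time_integral meas) (auto intro: continuous_on_subset[OF cont])
  have meas_r: "r t \<in> borel_measurable M" if "t \<in> {0..T}" for t
    unfolding r_def using meas[OF that] meas_int[OF that] by measurable
  have cont_r: "continuous_on {0..T} (\<lambda>t. r t \<omega>)" if "\<omega> \<in> space M" for \<omega>
  proof -
    have "continuous_on {0..T} (\<lambda>t. max 0 (h t \<omega> - b * integral {0..t} (\<lambda>s. h s \<omega>)))"
      by (intro continuous_intros cont[OF that] indefinite_integral_continuous_1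
          integrable_continuous_real)
    then show ?thesis
      by (rule continuous_on_eq) (simp add: r_def LINT[OF that])
  qed
  \<comment> \<open>\<open>Z\<close> and the exceptional null set depend on \<open>t\<close>. This
    is harmless, since different times are combined only after the expectation has been
    taken.\<close>
  have nn_r: "(\<integral>\<^sup>+\<omega>. ennreal (r t \<omega>) \<partial>M) \<le> ennreal C" if t: "t \<in> {0..T}" for t
  proof -
    obtain Z where Z: "\<forall>\<omega>. 0 \<le> Z \<omega>"
      "AE \<omega> in M. h t \<omega> \<le> Z \<omega> + b * (LINT s:{0..t}|lborel. h s \<omega>)"
      "(\<integral>\<^sup>+\<omega>. ennreal (Z \<omega>) \<partial>M) \<le> ennreal C"
      using bound[OF t] by auto
    have "AE \<omega> in M. ennreal (r t \<omega>) \<le> ennreal (Z \<omega>)"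
      using Z(2)
    proof eventually_elim
      case (elim \<omega>)
      then have "r t \<omega> \<le> Z \<omega>" using Z(1) unfolding r_def by simp
      then show ?case by (rule ennreal_leI)
    qed
    then show ?thesis by (rule order_trans[OF nn_integral_mono_AE Z(3)])
  qed
  have meas_r2: "(\<lambda>(\<omega>, t). indicator {0..T} t *\<^sub>R r t \<omega>) \<in> borel_measurable (M \<Otimes>\<^sub>M lborel)"
    by (rule borel_measurable_pair_continuous_paths[OF meas_r cont_r])
  have *: "ennreal (LINT t:{0..T}|lborel. r t \<omega>)
      = (\<integral>\<^sup>+t. ennreal (indicator {0..T} t *\<^sub>R r t \<omega>) \<partial>lborel)" if "\<omega> \<in> space M" for \<omega>
    unfolding set_lebesgue_integral_def
    using borel_integrable_atLeastAtMost'[OF cont_r[OF that]]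
    by (subst nn_integral_eq_integral) (auto simp: set_integrable_def r_def)
  have "(\<integral>\<^sup>+\<omega>. ennreal (LINT t:{0..T}|lborel. r t \<omega>) \<partial>M)
      = (\<integral>\<^sup>+\<omega>. \<integral>\<^sup>+t. ennreal (indicator {0..T} t *\<^sub>R r t \<omega>) \<partial>lborel \<partial>M)"
    by (rule nn_integral_cong) (rule *)
  also have "\<dots> = (\<integral>\<^sup>+t. \<integral>\<^sup>+\<omega>. ennreal (indicator {0..T} t *\<^sub>R r t \<omega>) \<partial>M \<partial>lborel)"
    using meas_r2 by (intro Fubini'[symmetric]) (simp add: split_beta')
  also have "\<dots> \<le> (\<integral>\<^sup>+t. ennreal C * indicator {0..T} t \<partial>lborel)"
    by (rule nn_integral_mono) (use nn_r in \<open>auto simp: indicator_def\<close>)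
  also have "\<dots> < \<infinity>"
    using \<open>0 \<le> T\<close> by (simp add: nn_integral_cmult ennreal_mult_less_top)
  finally have fin: "(\<integral>\<^sup>+\<omega>. ennreal (LINT t:{0..T}|lborel. r t \<omega>) \<partial>M) < \<infinity>" .
  have "integrable M (\<lambda>\<omega>. exp (b * T) * (LINT t:{0..T}|lborel. r t \<omega>))"
  proof (intro integrable_mult_right integrableI_nonneg)
    show "(\<lambda>\<omega>. LINT t:{0..T}|lborel. r t \<omega>) \<in> borel_measurable M"
      by (rule borel_measurable_time_integral[OF meas_r cont_r])
    show "AE \<omega> in M. 0 \<le> (LINT t:{0..T}|lborel. r t \<omega>)"
      by (auto simp: r_def set_lebesgue_integral_def intro!: integral_nonneg_AE)
  qed (use fin in simp)
  then show ?thesis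
  proof (rule Bochner_Integration.integrable_bound)
    show "(\<lambda>\<omega>. LINT t:{0..T}|lborel. h t \<omega>) \<in> borel_measurable M"
      using \<open>0 \<le> T\<close> by (intro meas_int) auto
    show "AE \<omega> in M. norm (LINT t:{0..T}|lborel. h t \<omega>)
        \<le> norm (exp (b * T) * (LINT t:{0..T}|lborel. r t \<omega>))"
    proof (rule AE_I2)
      fix \<omega> assume \<omega>: "\<omega> \<in> space M"
      have "integral {0..T} (\<lambda>t. h t \<omega>)
          \<le> exp (b * T) * integral {0..T} (\<lambda>t. max 0 (h t \<omega> - b * integral {0..t} (\<lambda>t. h t \<omega>)))"
        by (rule gronwall_integral[OF cont[OF \<omega>] \<open>0 \<le> T\<close> \<open>0 \<le> b\<close>])
      also have "integral {0..T} (\<lambda>t. max 0 (h t \<omega> - b * integral {0..t} (\<lambda>t. h t \<omega>)))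
          = (LINT t:{0..T}|lborel. r t \<omega>)"
        by (subst LINT_eq_integral[OF cont_r[OF \<omega>]], rule integral_cong)
          (simp add: r_def LINT[OF \<omega>])
      finally have "(LINT t:{0..T}|lborel. h t \<omega>) \<le> exp (b * T) * (LINT t:{0..T}|lborel. r t \<omega>)"
        using \<open>0 \<le> T\<close> by (simp add: LINT[OF \<omega>])
      moreover have "0 \<le> (LINT t:{0..T}|lborel. h t \<omega>)"
        by (auto simp: set_lebesgue_integral_def nonneg intro!: integral_nonneg_AE)
      ultimately show "norm (LINT t:{0..T}|lborel. h t \<omega>)
          \<le> norm (exp (b * T) * (LINT t:{0..T}|lborel. r t \<omega>))" by simp
    qed
  qed
qed

section \<open>Second moments of Ito integrals\<close>

lemma sets_natural_filtration_subset:
  assumes "\<forall>t\<ge>0. W t \<in> borel_measurable M"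
  shows "sets (natural_filtration M W t) \<subseteq> sets M"
  unfolding natural_filtration_def using assms
  by (subst sigma_le_sets) (auto intro!: measurable_sets)

text \<open>\<open>sigma\<close> falls back to a trivial algebra unless its generators are subsets
  of the space; inclusion of the generators in \<open>M\<close> rules this out.\<close>

lemma sets_augmented_filtration:
  assumes "\<forall>t\<ge>0. W t \<in> borel_measurable M"
  shows "sets (augmented_filtration M W t)
    = sigma_sets (space M) (sets (natural_filtration M W t) \<union> null_sets M)"
  unfolding augmented_filtration_def
proof (rule sets_measure_of)
  have "sets (natural_filtration M W t) \<union> null_sets M \<subseteq> sets M"
    using sets_natural_filtration_subset[OF assms] by auto
  then show "sets (natural_filtration M W t) \<union> null_sets M \<subseteq> Pow (space M)"
    using sets.space_closed by blast
qed

lemma space_augmented_filtration [simp]: "space (augmented_filtration M W t) = space M"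
  by (simp add: augmented_filtration_def space_measure_of_conv)

lemma subalgebra_augmented_filtration:
  assumes "\<forall>t\<ge>0. W t \<in> borel_measurable M"
  shows "subalgebra M (augmented_filtration M W t)"
proof -
  have "sigma_sets (space M) (sets (natural_filtration M W t) \<union> null_sets M) \<subseteq> sets M"
    using sets_natural_filtration_subset[OF assms] by (intro sets.sigma_sets_subset) auto
  then show ?thesis
    by (simp add: subalgebra_def sets_augmented_filtration[OF assms])
qed

lemma augmented_filtration_mono:
  assumes "\<forall>t\<ge>0. W t \<in> borel_measurable M" and "s \<le> t"
  shows "subalgebra (augmented_filtration M W t) (augmented_filtration M W s)"
proof -
  have "sets (natural_filtration M W s) \<subseteq> sets (natural_filtration M W t)"
    unfolding natural_filtration_def
    by (subst (1 2) sets_measure_of, blast, blast)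
      (intro sigma_sets_mono', use order_trans[OF _ \<open>s \<le> t\<close>] in blast)
  then have "sigma_sets (space M) (sets (natural_filtration M W s) \<union> null_sets M)
      \<subseteq> sigma_sets (space M) (sets (natural_filtration M W t) \<union> null_sets M)"
    by (intro sigma_sets_mono') auto
  then show ?thesis
    by (simp add: subalgebra_def sets_augmented_filtration[OF assms(1)])
qed

lemma adapted_augmented_filtration:
  fixes W :: "real \<Rightarrow> 'w \<Rightarrow> 'b::topological_space"
  assumes "\<forall>t\<ge>0. W t \<in> borel_measurable M" and "0 \<le> s" "s \<le> t"
  shows "W s \<in> borel_measurable (augmented_filtration M W t)"
proof (rule measurableI)
  fix B :: "'b set" assume B: "B \<in> sets borel"
  have "W s -` B \<inter> space M \<in> sets (natural_filtration M W t)"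
    unfolding natural_filtration_def using assms(2,3) B
    by (subst sets_measure_of) auto
  then show "W s -` B \<inter> space (augmented_filtration M W t) \<in> sets (augmented_filtration M W t)"
    by (simp add: sets_augmented_filtration[OF assms(1)] sigma_sets.Basic)
qed simp

text \<open>The sets that agree almost everywhere with a set of the natural filtration form a
  \<sigma>-algebra containing all null sets. Probabilities cannot tell the two sets apart, so
  independence carries over to the augmentation.\<close>

lemma augmented_filtration_AE_eq:
  assumes "\<forall>t\<ge>0. W t \<in> borel_measurable M"
    and "A \<in> sets (augmented_filtration M W t)"
  shows "\<exists>B\<in>sets (natural_filtration M W t). AE \<omega> in M. \<omega> \<in> A \<longleftrightarrow> \<omega> \<in> B"
proof -
  have space: "space (natural_filtration M W t) = space M"
    by (simp add: natural_filtration_def space_measure_of_conv)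
  have "A \<in> sigma_sets (space M) (sets (natural_filtration M W t) \<union> null_sets M)"
    using assms(2) by (simp add: sets_augmented_filtration[OF assms(1)])
  then show ?thesis
  proof induction
    case (Basic A)
    then show ?case
    proof
      assume "A \<in> null_sets M"
      then have "AE \<omega> in M. \<omega> \<in> A \<longleftrightarrow> \<omega> \<in> {}" by (auto dest: AE_not_in)
      then show ?thesis by blast
    qed blast
  next
    case Empty
    show ?case by (rule bexI[of _ "{}"]) auto
  next
    case (Compl A)
    then obtain B where "B \<in> sets (natural_filtration M W t)" "AE \<omega> in M. \<omega> \<in> A \<longleftrightarrow> \<omega> \<in> B"
      by blast
    then show ?case
      using sets.compl_sets[of B "natural_filtration M W t"] space
      by (intro bexI[of _ "space M - B"]) auto
  next
    case (Union A)
    then obtain B where B: "\<And>i. B i \<in> sets (natural_filtration M W t)"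
      "\<And>i. AE \<omega> in M. \<omega> \<in> A i \<longleftrightarrow> \<omega> \<in> B i"
      by metis
    have "AE \<omega> in M. \<forall>i. \<omega> \<in> A i \<longleftrightarrow> \<omega> \<in> B i"
      using B(2) by (simp add: AE_all_countable)
    then have "AE \<omega> in M. \<omega> \<in> (\<Union>i. A i) \<longleftrightarrow> \<omega> \<in> (\<Union>i. B i)"
      by eventually_elim auto
    then show ?case using B(1) by blast
  qed
qed

lemma brownian_motionD:
  assumes "brownian_motion M W"
  shows brownian_motion_prob_space: "prob_space M"
    and brownian_motion_measurable: "\<forall>t\<ge>0. W t \<in> borel_measurable M"
  using assms by (auto simp: brownian_motion_def)

text \<open>The function \<open>g\<close> is there for two uses: a coordinate of the increment in
  the cross term, and its squared norm in the quadratic term of the second moment.\<close>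

lemma brownian_motion_indep_var:
  fixes W :: "real \<Rightarrow> 'w \<Rightarrow> real^'m"
  assumes bm: "brownian_motion M W" and "0 \<le> s" "s < t"
    and Y: "Y \<in> borel_measurable (augmented_filtration M W s)"
    and g: "g \<in> borel_measurable borel"
  shows "prob_space.indep_var M borel Y borel (\<lambda>\<omega>. g (W t \<omega> - W s \<omega>))"
proof -
  note meas = brownian_motion_measurable[OF bm]
  interpret prob_space M by (rule brownian_motion_prob_space[OF bm])
  let ?F = "augmented_filtration M W s" and ?D = "\<lambda>\<omega>. W t \<omega> - W s \<omega>"
  let ?V = "vimage_algebra (space M) ?D borel"
  have Y_M: "Y \<in> borel_measurable M"
    by (rule measurable_from_subalg[OF subalgebra_augmented_filtration[OF meas] Y])
  have F_M: "sets ?F \<subseteq> events"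
    using subalgebra_augmented_filtration[OF meas] by (simp add: subalgebra_def)
  have D_M: "?D \<in> borel_measurable M"
    using \<open>0 \<le> s\<close> \<open>s < t\<close> by (intro borel_measurable_diff) (simp_all add: meas)
  have gD_M: "(\<lambda>\<omega>. g (?D \<omega>)) \<in> borel_measurable M"
    by (rule measurable_compose[OF D_M g])
  have indep: "indep_set (sets ?V) (sets (natural_filtration M W s))"
    using bm \<open>0 \<le> s\<close> \<open>s < t\<close> by (simp add: brownian_motion_def)
  have Y_F: "sigma_sets (space M) {Y -` A \<inter> space M |A. A \<in> sets borel} \<subseteq> sets ?F"
    by (rule sets.sigma_sets_subset[of _ ?F, unfolded space_augmented_filtration])
      (use measurable_sets[OF Y] in auto)
  have gD: "(\<lambda>\<omega>. g (?D \<omega>)) \<in> borel_measurable ?V"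
    using measurable_vimage_algebra1[of ?D "space M" borel] by (intro measurable_compose[OF _ g]) simp
  have gD_V: "sigma_sets (space M) {(\<lambda>\<omega>. g (?D \<omega>)) -` A \<inter> space M |A. A \<in> sets borel} \<subseteq> sets ?V"
    by (rule sets.sigma_sets_subset[of _ ?V, unfolded space_vimage_algebra])
      (use measurable_sets[OF gD] in auto)
  have "indep_set (sigma_sets (space M) {Y -` A \<inter> space M |A. A \<in> sets borel})
      (sigma_sets (space M) {(\<lambda>\<omega>. g (?D \<omega>)) -` A \<inter> space M |A. A \<in> sets borel})"
  proof (rule indep_setI)
    show "sigma_sets (space M) {Y -` A \<inter> space M |A. A \<in> sets borel} \<subseteq> events"
      using Y_F F_M by (rule order_trans)
    show "sigma_sets (space M) {(\<lambda>\<omega>. g (?D \<omega>)) -` A \<inter> space M |A. A \<in> sets borel} \<subseteq> events"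
      using gD_V indep_setD_ev1[OF indep] by blast
    fix a b
    assume a: "a \<in> sigma_sets (space M) {Y -` A \<inter> space M |A. A \<in> sets borel}"
      and b: "b \<in> sigma_sets (space M) {(\<lambda>\<omega>. g (?D \<omega>)) -` A \<inter> space M |A. A \<in> sets borel}"
    have aF: "a \<in> sets ?F" and bV: "b \<in> sets ?V" using a b Y_F gD_V by auto
    have aM: "a \<in> events" using aF F_M by blast
    have bM: "b \<in> events" using bV indep_setD_ev1[OF indep] by blast
    \<comment> \<open>Independence of the increment is known for \<open>c\<close>, a set of the
      natural filtration, and is transferred to \<open>a\<close> because both have the same
      probability, alone and after intersection with \<open>b\<close>.\<close>
    obtain c where c: "c \<in> sets (natural_filtration M W s)" "AE \<omega> in M. \<omega> \<in> a \<longleftrightarrow> \<omega> \<in> c"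
      using augmented_filtration_AE_eq[OF meas aF] by blast
    have cM: "c \<in> events" using c(1) indep_setD_ev2[OF indep] by blast
    have "prob (a \<inter> b) = prob (b \<inter> c)"
      by (rule finite_measure_eq_AE) (use c(2) aM bM cM in auto)
    also have "\<dots> = prob b * prob c" by (rule indep_setD[OF indep bV c(1)])
    also have "prob c = prob a"
      by (rule finite_measure_eq_AE) (use c(2) aM cM in auto)
    finally show "prob (a \<inter> b) = prob a * prob b" by simp
  qed
  then show ?thesis
    unfolding indep_var_eq using Y_M gD_M by blast
qed

section \<open>Second moments of increments and of integrals of simple integrands\<close>

lemma brownian_increment_moments:
  fixes W :: "real \<Rightarrow> 'w \<Rightarrow> real^'m" and s t :: real
  assumes bm: "brownian_motion M W" and "0 \<le> s" "s < t"
  shows "integrable M (\<lambda>\<omega>. (W t \<omega> - W s \<omega>) $ j)"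
    and "(\<integral>\<omega>. (W t \<omega> - W s \<omega>) $ j \<partial>M) = 0"
    and "integrable M (\<lambda>\<omega>. (norm (W t \<omega> - W s \<omega>))\<^sup>2)"
    and "(\<integral>\<omega>. (norm (W t \<omega> - W s \<omega>))\<^sup>2 \<partial>M) = CARD('m) * (t - s)"
proof -
  let ?D = "\<lambda>\<omega>. W t \<omega> - W s \<omega>" and ?N = "normal_density 0 (sqrt (t - s))"
  have pos: "0 < sqrt (t - s)" using \<open>s < t\<close> by simp
  have distr: "distributed M lborel (\<lambda>\<omega>. ?D \<omega> $ j) (\<lambda>x. ennreal (?N x))" for j
    using bm assms(2,3) by (simp add: brownian_motion_def)
  show "integrable M (\<lambda>\<omega>. ?D \<omega> $ j)"
    using distributed_integrable[OF distr, of "\<lambda>x. x" j] integrable_normal_moment[OF pos, of 0 1]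
    by simp
  show "(\<integral>\<omega>. ?D \<omega> $ j \<partial>M) = 0"
    using distributed_integral[OF distr, of "\<lambda>x. x" j] integral_normal_moment_odd[OF pos, of 0 0]
    by simp
  have int: "integrable M (\<lambda>\<omega>. (?D \<omega> $ j)\<^sup>2)" for j
    using distributed_integrable[OF distr, of "\<lambda>x. x\<^sup>2" j] integrable_normal_moment[OF pos, of 0 2]
    by simp
  \<comment> \<open>The even moment formula is indexed by half the order, so the index 1 selects the
    variance.\<close>
  have var: "(\<integral>\<omega>. (?D \<omega> $ j)\<^sup>2 \<partial>M) = t - s" for j
    using distributed_integral[OF distr, of "\<lambda>x. x\<^sup>2" j]
      integral_normal_moment_even[OF pos, of 0 1] \<open>s < t\<close>
    by (simp add: numeral_2_eq_2[symmetric])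
  have norm: "(norm (?D \<omega>))\<^sup>2 = (\<Sum>j\<in>UNIV. (?D \<omega> $ j)\<^sup>2)" for \<omega>
    by (simp add: power2_norm_eq_inner inner_vec_def) (simp add: power2_eq_square)
  show "integrable M (\<lambda>\<omega>. (norm (?D \<omega>))\<^sup>2)"
    unfolding norm by (intro Bochner_Integration.integrable_sum int)
  show "(\<integral>\<omega>. (norm (?D \<omega>))\<^sup>2 \<partial>M) = CARD('m) * (t - s)"
    unfolding norm by (subst Bochner_Integration.integral_sum[OF int]) (simp only: var, simp)
qed

text \<open>The norm of nested vectors is the Frobenius norm, so Cauchy-Schwarz in each row
  suffices.\<close>

lemma norm_matrix_vector_le:
  fixes A :: "real^'m^'d"
  shows "norm (A *v x) \<le> norm A * norm x"
proof -
  have "norm (A *v x) \<le> L2_set (\<lambda>i. norm (A $ i) * norm x) UNIV"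
    unfolding norm_vec_def[of "A *v x"]
    by (rule L2_set_mono) (auto simp: matrix_vector_mul_component intro: Cauchy_Schwarz_ineq2)
  also have "\<dots> = norm A * norm x"
    by (simp add: norm_vec_def[of A] L2_set_left_distrib)
  finally show ?thesis .
qed

lemma borel_measurable_vec_nth:
  "(\<lambda>x :: 'b::topological_space^'n. x $ i) \<in> borel_measurable borel"
  by (intro borel_measurable_continuous_onI continuous_intros)

text \<open>The upper half of the Ito isometry. The factor \<open>CARD('m)\<close> is the price of
  bounding the product of a matrix and an increment by the product of their norms, the increment
  having second moment \<open>CARD('m)\<close> times the step length. Measurability at
  \<open>\<tau> n\<close> and \<open>0 \<le> \<tau> n\<close> belong to the claim because the
  induction step needs the next increment to be independent of the sum so far.\<close>

lemma simple_integral_second_moment: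
  fixes W :: "real \<Rightarrow> 'w \<Rightarrow> real^'m" and \<eta> :: "nat \<Rightarrow> 'w \<Rightarrow> real^'m^'d"
  assumes bm: "brownian_motion M W"
    and simple: "simple_integrand M (augmented_filtration M W) t n \<tau> \<eta>"
  shows "simple_integral W n \<tau> \<eta> \<in> borel_measurable (augmented_filtration M W (\<tau> n))
    \<and> integrable M (\<lambda>\<omega>. (norm (simple_integral W n \<tau> \<eta> \<omega>))\<^sup>2)
    \<and> (\<integral>\<omega>. (norm (simple_integral W n \<tau> \<eta> \<omega>))\<^sup>2 \<partial>M)
      \<le> CARD('m) * (\<Sum>k<n. (\<tau> (Suc k) - \<tau> k) * (\<integral>\<omega>. (norm (\<eta> k \<omega>))\<^sup>2 \<partial>M))
    \<and> 0 \<le> \<tau> n"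
  using simple
proof (induction n)
  case 0
  then show ?case by (simp add: simple_integral_def[abs_def] simple_integrand_def)
next
  case (Suc n)
  note meas = brownian_motion_measurable[OF bm]
  interpret prob_space M by (rule brownian_motion_prob_space[OF bm])
  let ?F = "augmented_filtration M W"
  define S where "S = simple_integral W n \<tau> \<eta>"
  define E where "E = \<eta> n"
  define D where "D \<omega> = W (\<tau> (Suc n)) \<omega> - W (\<tau> n) \<omega>" for \<omega>
  have step: "\<tau> n \<le> \<tau> (Suc n)" and "simple_integrand M ?F t n \<tau> \<eta>"
    and E_F: "E \<in> borel_measurable (?F (\<tau> n))"
    using Suc.prems unfolding simple_integrand_def E_def
    by (auto intro: order_trans) (meson less_SucI)
  then have S_F: "S \<in> borel_measurable (?F (\<tau> n))"
    and S_int: "integrable M (\<lambda>\<omega>. (norm (S \<omega>))\<^sup>2)"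
    and S_le: "(\<integral>\<omega>. (norm (S \<omega>))\<^sup>2 \<partial>M)
      \<le> CARD('m) * (\<Sum>k<n. (\<tau> (Suc k) - \<tau> k) * (\<integral>\<omega>. (norm (\<eta> k \<omega>))\<^sup>2 \<partial>M))"
    and "0 \<le> \<tau> n"
    using Suc.IH by (auto simp: S_def)
  obtain c where c: "\<And>\<omega>. \<omega> \<in> space M \<Longrightarrow> norm (E \<omega>) \<le> c"
    using Suc.prems unfolding simple_integrand_def E_def by (meson lessI)
  note to_M = measurable_from_subalg[OF subalgebra_augmented_filtration[OF meas]]
  have S_M: "S \<in> borel_measurable M" and E_M: "E \<in> borel_measurable M"
    using S_F E_F by (auto intro: to_M)
  \<comment> \<open>The cross term is expanded into coordinates so that everything known at
    \<open>\<tau> n\<close> is gathered in one scalar factor, to be set against one coordinate of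
    the increment.\<close>
  have SE_F: "(\<lambda>\<omega>. S \<omega> $ i * E \<omega> $ i $ j) \<in> borel_measurable (?F (\<tau> n))" for i j
    using S_F E_F by (intro borel_measurable_times measurable_compose[OF _ borel_measurable_vec_nth]
        measurable_compose[OF measurable_compose[OF _ borel_measurable_vec_nth] borel_measurable_vec_nth])
  \<comment> \<open>\<open>E\<close> is bounded and \<open>S\<close> only square integrable;
    \<open>1 + (norm S)\<^sup>2\<close> serves as a majorant for the first power.\<close>
  have SE_int: "integrable M (\<lambda>\<omega>. S \<omega> $ i * E \<omega> $ i $ j)" for i j
  proof (rule Bochner_Integration.integrable_bound)
    show "integrable M (\<lambda>\<omega>. (1 + (norm (S \<omega>))\<^sup>2) * c)" using S_int by simp
    show "AE \<omega> in M. norm (S \<omega> $ i * E \<omega> $ i $ j) \<le> norm ((1 + (norm (S \<omega>))\<^sup>2) * c)"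
    proof (rule AE_I2)
      fix \<omega> assume "\<omega> \<in> space M"
      have "norm (S \<omega> $ i) \<le> norm (S \<omega>)" by (rule Finite_Cartesian_Product.norm_nth_le)
      also have "\<dots> \<le> 1 + (norm (S \<omega>))\<^sup>2"
        using zero_le_power2[of "norm (S \<omega>) - 1"] by (simp add: power2_diff) (smt (verit) norm_ge_zero)
      finally have 1: "norm (S \<omega> $ i) \<le> 1 + (norm (S \<omega>))\<^sup>2" .
      have 2: "norm (E \<omega> $ i $ j) \<le> c"
        using Finite_Cartesian_Product.norm_nth_le[of "E \<omega> $ i" j] Finite_Cartesian_Product.norm_nth_le[of "E \<omega>" i] c[OF \<open>\<omega> \<in> space M\<close>] by linarith
      have "norm (S \<omega> $ i * E \<omega> $ i $ j) \<le> (1 + (norm (S \<omega>))\<^sup>2) * c"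
        unfolding norm_mult by (rule mult_mono[OF 1 2]) auto
      then show "norm (S \<omega> $ i * E \<omega> $ i $ j) \<le> norm ((1 + (norm (S \<omega>))\<^sup>2) * c)"
        by simp
    qed
  qed (rule to_M[OF SE_F])
  have E2_int: "integrable M (\<lambda>\<omega>. (norm (E \<omega>))\<^sup>2)"
    using E_M c by (intro integrable_const_bound[where B="c\<^sup>2"])
      (auto intro!: AE_I2 power_mono)
  have S': "simple_integral W (Suc n) \<tau> \<eta> = (\<lambda>\<omega>. S \<omega> + E \<omega> *v D \<omega>)"
    by (simp add: fun_eq_iff simple_integral_def S_def E_def D_def)
  have ED: "(E \<omega> *v D \<omega>) $ i = (\<Sum>j\<in>UNIV. E \<omega> $ i $ j * D \<omega> $ j)" for \<omega> i
    by (simp add: matrix_vector_mult_def)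
  have S'_F: "simple_integral W (Suc n) \<tau> \<eta> \<in> borel_measurable (?F (\<tau> (Suc n)))"
  proof -
    have [measurable]: "S \<in> borel_measurable (?F (\<tau> (Suc n)))" "E \<in> borel_measurable (?F (\<tau> (Suc n)))"
      using S_F E_F augmented_filtration_mono[OF meas step] by (auto intro: measurable_from_subalg)
    have "W (\<tau> (Suc n)) \<in> borel_measurable (?F (\<tau> (Suc n)))"
      "W (\<tau> n) \<in> borel_measurable (?F (\<tau> (Suc n)))"
      using \<open>0 \<le> \<tau> n\<close> step by (auto intro!: adapted_augmented_filtration meas)
    then have [measurable]: "D \<in> borel_measurable (?F (\<tau> (Suc n)))"
      unfolding D_def by measurable
    have "continuous_on UNIV (\<lambda>(A, x). (A :: real^'m^'d) *v x)"
      unfolding split_beta matrix_vector_mult_def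
      by (intro continuous_intros)
    then have [measurable]: "(\<lambda>(A, x). (A :: real^'m^'d) *v x) \<in> borel_measurable borel"
      by (rule borel_measurable_continuous_onI)
    have "(\<lambda>\<omega>. (\<lambda>(A, x). A *v x) (E \<omega>, D \<omega>)) \<in> borel_measurable (?F (\<tau> (Suc n)))"
      by measurable
    then show ?thesis unfolding S' by simp
  qed
  show ?case
  \<comment> \<open>Neighbouring grid points may coincide, while \<open>brownian_motion\<close>
    describes increments only over \<open>s < t\<close>; a step of length zero contributes
    nothing.\<close>
  proof (cases "\<tau> n = \<tau> (Suc n)")
    case True
    then have "D \<omega> = 0" for \<omega> by (simp add: D_def)
    then show ?thesis
      using S'_F S_int S_le \<open>0 \<le> \<tau> n\<close> True by (simp add: S')
  next
    case False
    then have less: "\<tau> n < \<tau> (Suc n)" using step by simp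
    note mom = brownian_increment_moments[OF bm \<open>0 \<le> \<tau> n\<close> less, folded D_def]
    \<comment> \<open>The increment is centred and independent of the past, so the cross term vanishes.\<close>
    have ind1: "indep_var borel (\<lambda>\<omega>. S \<omega> $ i * E \<omega> $ i $ j) borel (\<lambda>\<omega>. D \<omega> $ j)" for i j
      unfolding D_def
      by (rule brownian_motion_indep_var[OF bm \<open>0 \<le> \<tau> n\<close> less SE_F, of "\<lambda>x. x $ j"])
        (rule borel_measurable_vec_nth)
    have ind2: "indep_var borel (\<lambda>\<omega>. (norm (E \<omega>))\<^sup>2) borel (\<lambda>\<omega>. (norm (D \<omega>))\<^sup>2)"
      unfolding D_def
      by (rule brownian_motion_indep_var[OF bm \<open>0 \<le> \<tau> n\<close> less, of _ "\<lambda>x. (norm x)\<^sup>2"])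
        (use E_F in measurable)
    have SED: "S \<omega> \<bullet> (E \<omega> *v D \<omega>) = (\<Sum>i\<in>UNIV. \<Sum>j\<in>UNIV. (S \<omega> $ i * E \<omega> $ i $ j) * D \<omega> $ j)" for \<omega>
      by (simp add: inner_vec_def ED sum_distrib_left mult.assoc)
    have SED_int: "integrable M (\<lambda>\<omega>. S \<omega> $ i * E \<omega> $ i $ j * D \<omega> $ j)" for i j
      by (rule indep_var_integrable[OF ind1 SE_int mom(1)])
    have "(\<integral>\<omega>. S \<omega> $ i * E \<omega> $ i $ j * D \<omega> $ j \<partial>M) = 0" for i j
      using indep_var_lebesgue_integral[OF ind1 SE_int mom(1)] by (simp add: mom(2))
    then have "(\<integral>\<omega>. (\<Sum>j\<in>UNIV. S \<omega> $ i * E \<omega> $ i $ j * D \<omega> $ j) \<partial>M) = 0" for i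
      by (subst Bochner_Integration.integral_sum[OF SED_int]) simp
    then have cross: "(\<integral>\<omega>. S \<omega> \<bullet> (E \<omega> *v D \<omega>) \<partial>M) = 0"
      unfolding SED
      by (subst Bochner_Integration.integral_sum)
        (auto intro!: Bochner_Integration.integrable_sum SED_int)
    have cross_int: "integrable M (\<lambda>\<omega>. S \<omega> \<bullet> (E \<omega> *v D \<omega>))"
      unfolding SED by (intro Bochner_Integration.integrable_sum SED_int)
    have prod_int: "integrable M (\<lambda>\<omega>. (norm (E \<omega>))\<^sup>2 * (norm (D \<omega>))\<^sup>2)"
      by (rule indep_var_integrable[OF ind2 E2_int mom(3)])
    have prod: "(\<integral>\<omega>. (norm (E \<omega>))\<^sup>2 * (norm (D \<omega>))\<^sup>2 \<partial>M)
        = (\<integral>\<omega>. (norm (E \<omega>))\<^sup>2 \<partial>M) * (CARD('m) * (\<tau> (Suc n) - \<tau> n))"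
      using indep_var_lebesgue_integral[OF ind2 E2_int mom(3)] by (simp add: mom(4))
    \<comment> \<open>With the last square bounded by a product of norms, only two independent
      scalar factors remain, and covariances between coordinates of the increment never
      arise.\<close>
    have le: "(norm (S \<omega> + E \<omega> *v D \<omega>))\<^sup>2
        \<le> (norm (S \<omega>))\<^sup>2 + 2 * (S \<omega> \<bullet> (E \<omega> *v D \<omega>)) + (norm (E \<omega>))\<^sup>2 * (norm (D \<omega>))\<^sup>2" for \<omega>
    proof -
      have "(norm (S \<omega> + E \<omega> *v D \<omega>))\<^sup>2
          = (norm (S \<omega>))\<^sup>2 + 2 * (S \<omega> \<bullet> (E \<omega> *v D \<omega>)) + (norm (E \<omega> *v D \<omega>))\<^sup>2"
        by (simp add: power2_norm_eq_inner inner_add_left inner_add_right inner_commute)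
      also have "(norm (E \<omega> *v D \<omega>))\<^sup>2 \<le> (norm (E \<omega>) * norm (D \<omega>))\<^sup>2"
        by (intro power_mono norm_matrix_vector_le) simp
      finally show ?thesis by (simp add: power_mult_distrib)
    qed
    have rhs_int: "integrable M (\<lambda>\<omega>. (norm (S \<omega>))\<^sup>2 + 2 * (S \<omega> \<bullet> (E \<omega> *v D \<omega>))
        + (norm (E \<omega>))\<^sup>2 * (norm (D \<omega>))\<^sup>2)"
      using S_int cross_int prod_int by simp
    have S'_int: "integrable M (\<lambda>\<omega>. (norm (S \<omega> + E \<omega> *v D \<omega>))\<^sup>2)"
    proof (rule Bochner_Integration.integrable_bound[OF rhs_int])
      show "(\<lambda>\<omega>. (norm (S \<omega> + E \<omega> *v D \<omega>))\<^sup>2) \<in> borel_measurable M"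
        using to_M[OF S'_F] unfolding S' by measurable
      show "AE \<omega> in M. norm ((norm (S \<omega> + E \<omega> *v D \<omega>))\<^sup>2) \<le> norm ((norm (S \<omega>))\<^sup>2
          + 2 * (S \<omega> \<bullet> (E \<omega> *v D \<omega>)) + (norm (E \<omega>))\<^sup>2 * (norm (D \<omega>))\<^sup>2)"
        using le by (intro AE_I2) (smt (verit) real_norm_def zero_le_power2)
    qed
    have "(\<integral>\<omega>. (norm (S \<omega> + E \<omega> *v D \<omega>))\<^sup>2 \<partial>M)
        \<le> (\<integral>\<omega>. (norm (S \<omega>))\<^sup>2 + 2 * (S \<omega> \<bullet> (E \<omega> *v D \<omega>)) + (norm (E \<omega>))\<^sup>2 * (norm (D \<omega>))\<^sup>2 \<partial>M)"
      by (rule integral_mono[OF S'_int rhs_int le])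
    also have "\<dots> = (\<integral>\<omega>. (norm (S \<omega>))\<^sup>2 \<partial>M)
        + CARD('m) * ((\<tau> (Suc n) - \<tau> n) * (\<integral>\<omega>. (norm (E \<omega>))\<^sup>2 \<partial>M))"
      using S_int cross_int prod_int cross prod by simp
    finally show ?thesis
      using S'_F S'_int S_le \<open>0 \<le> \<tau> n\<close> step
      by (simp add: S' E_def distrib_left)
  qed
qed

text \<open>The half-open grid intervals are pairwise disjoint, so at each \<open>s\<close> at most
  one summand survives and there are no mixed terms.\<close>

lemma norm_simple_value_square:
  assumes "\<forall>k<n. \<tau> k \<le> \<tau> (Suc k)"
  shows "(norm (simple_value n \<tau> \<eta> s \<omega>))\<^sup>2
    = (\<Sum>k<n. indicator {\<tau> k<..\<tau> (Suc k)} s * (norm (\<eta> k \<omega>))\<^sup>2)"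
  using assms
proof (induction n)
  case 0
  then show ?case by (simp add: simple_value_def)
next
  case (Suc n)
  have step: "\<tau> k \<le> \<tau> (Suc k)" if "k < n" for k
    using Suc.prems that by simp
  have mono: "\<tau> (Suc k) \<le> \<tau> n" if "k < n" for k
    by (rule inc_induct[OF Suc_leI[OF that], of "\<lambda>k. \<tau> k \<le> \<tau> n"])
      (auto intro: order_trans[OF step])
  show ?case
  proof (cases "\<tau> n < s")
    case True
    then have "s \<notin> {\<tau> k<..\<tau> (Suc k)}" if "k < n" for k using mono[OF that] by simp
    then have 1: "(\<Sum>k<n. indicator {\<tau> k<..\<tau> (Suc k)} s *\<^sub>R \<eta> k \<omega>) = 0"
      and 2: "(\<Sum>k<n. indicator {\<tau> k<..\<tau> (Suc k)} s * (norm (\<eta> k \<omega>))\<^sup>2) = 0"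
      by (auto intro!: sum.neutral)
    show ?thesis
      unfolding simple_value_def sum.lessThan_Suc 1 2
      by (cases "s \<in> {\<tau> n<..\<tau> (Suc n)}") simp_all
  next
    case False
    then show ?thesis using Suc by (simp add: simple_value_def)
  qed
qed

text \<open>Identifies the weighted sum in the second-moment estimate as the squared norm of the
  simple integrand in time. All grid intervals lie in \<open>{0..t}\<close>, so the restriction to
  that set is absorbed.\<close>

lemma nn_integral_simple_value:
  assumes "0 \<le> \<tau> 0" "\<forall>k<n. \<tau> k \<le> \<tau> (Suc k)" "\<tau> n \<le> t"
  shows "(\<integral>\<^sup>+s\<in>{0..t}. ennreal ((norm (simple_value n \<tau> \<eta> s \<omega>))\<^sup>2) \<partial>lborel)
    = ennreal (\<Sum>k<n. (\<tau> (Suc k) - \<tau> k) * (norm (\<eta> k \<omega>))\<^sup>2)"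
proof -
  have lower: "0 \<le> \<tau> k" if "k \<le> n" for k
    using that assms by (induction k) (auto intro: order_trans)
  have upper: "\<tau> k \<le> t" if "k \<le> n" for k
    using that by (induction rule: inc_induct) (use assms in \<open>auto intro: order_trans\<close>)
  have sub: "{\<tau> k<..\<tau> (Suc k)} \<subseteq> {0..t}" if "k < n" for k
    using lower[of k] upper[of "Suc k"] that by auto
  have eq: "ennreal ((norm (simple_value n \<tau> \<eta> s \<omega>))\<^sup>2) * indicator {0..t} s
      = (\<Sum>k<n. ennreal ((norm (\<eta> k \<omega>))\<^sup>2) * indicator {\<tau> k<..\<tau> (Suc k)} s)" for s
  proof -
    have 1: "ennreal ((norm (simple_value n \<tau> \<eta> s \<omega>))\<^sup>2)
        = (\<Sum>k<n. ennreal (indicator {\<tau> k<..\<tau> (Suc k)} s * (norm (\<eta> k \<omega>))\<^sup>2))"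
      unfolding norm_simple_value_square[OF assms(2)] by (rule sum_ennreal[symmetric]) simp
    have 2: "ennreal (indicator {\<tau> k<..\<tau> (Suc k)} s * (norm (\<eta> k \<omega>))\<^sup>2) * indicator {0..t} s
        = ennreal ((norm (\<eta> k \<omega>))\<^sup>2) * indicator {\<tau> k<..\<tau> (Suc k)} s" if "k < n" for k
      using sub[OF that] by (cases "s \<in> {\<tau> k<..\<tau> (Suc k)}") auto
    show ?thesis
      unfolding 1 sum_distrib_right by (rule sum.cong[OF refl]) (simp only: 2 lessThan_iff)
  qed
  have "(\<integral>\<^sup>+s\<in>{0..t}. ennreal ((norm (simple_value n \<tau> \<eta> s \<omega>))\<^sup>2) \<partial>lborel)
      = (\<Sum>k<n. \<integral>\<^sup>+s. ennreal ((norm (\<eta> k \<omega>))\<^sup>2) * indicator {\<tau> k<..\<tau> (Suc k)} s \<partial>lborel)"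
    unfolding eq by (rule nn_integral_sum) measurable
  also have "\<dots> = (\<Sum>k<n. ennreal ((norm (\<eta> k \<omega>))\<^sup>2) * ennreal (\<tau> (Suc k) - \<tau> k))"
    using assms(2) by (intro sum.cong refl) (simp add: nn_integral_cmult_indicator)
  also have "\<dots> = (\<Sum>k<n. ennreal ((\<tau> (Suc k) - \<tau> k) * (norm (\<eta> k \<omega>))\<^sup>2))"
    using assms(2) by (intro sum.cong refl) (simp add: ennreal_mult' mult.commute)
  also have "\<dots> = ennreal (\<Sum>k<n. (\<tau> (Suc k) - \<tau> k) * (norm (\<eta> k \<omega>))\<^sup>2)"
    using assms(2) by (intro sum_ennreal) simp
  finally show ?thesis .
qed

lemma nn_integral_simple_integral_le:
  fixes W :: "real \<Rightarrow> 'w \<Rightarrow> real^'m" and \<eta> :: "nat \<Rightarrow> 'w \<Rightarrow> real^'m^'d"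
  assumes bm: "brownian_motion M W"
    and simple: "simple_integrand M (augmented_filtration M W) t n \<tau> \<eta>"
  shows "(\<integral>\<^sup>+\<omega>. ennreal ((norm (simple_integral W n \<tau> \<eta> \<omega>))\<^sup>2) \<partial>M)
    \<le> ennreal CARD('m) *
      (\<integral>\<^sup>+\<omega>. (\<integral>\<^sup>+s\<in>{0..t}. ennreal ((norm (simple_value n \<tau> \<eta> s \<omega>))\<^sup>2) \<partial>lborel) \<partial>M)"
proof -
  interpret prob_space M by (rule brownian_motion_prob_space[OF bm])
  note moment = simple_integral_second_moment[OF bm simple]
  have \<tau>: "0 \<le> \<tau> 0" "\<forall>k<n. \<tau> k \<le> \<tau> (Suc k)" "\<tau> n \<le> t"
    using simple by (auto simp: simple_integrand_def)
  obtain c where c: "\<forall>k<n. \<forall>\<omega>\<in>space M. norm (\<eta> k \<omega>) \<le> c"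
    using simple by (auto simp: simple_integrand_def)
  have \<eta>_int: "integrable M (\<lambda>\<omega>. (norm (\<eta> k \<omega>))\<^sup>2)" if "k < n" for k
  proof (rule integrable_const_bound[where B="c\<^sup>2"])
    have "\<eta> k \<in> borel_measurable M"
      using simple that measurable_from_subalg[OF
          subalgebra_augmented_filtration[OF brownian_motion_measurable[OF bm]]]
      unfolding simple_integrand_def by blast
    then show "(\<lambda>\<omega>. (norm (\<eta> k \<omega>))\<^sup>2) \<in> borel_measurable M" by measurable
    show "AE \<omega> in M. norm ((norm (\<eta> k \<omega>))\<^sup>2) \<le> c\<^sup>2"
      using c that by (auto intro!: AE_I2 power_mono)
  qed
  have "(\<integral>\<^sup>+\<omega>. ennreal ((norm (simple_integral W n \<tau> \<eta> \<omega>))\<^sup>2) \<partial>M)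
      = ennreal (\<integral>\<omega>. (norm (simple_integral W n \<tau> \<eta> \<omega>))\<^sup>2 \<partial>M)"
    using moment by (intro nn_integral_eq_integral) auto
  also have "\<dots> \<le> ennreal (CARD('m) * (\<Sum>k<n. (\<tau> (Suc k) - \<tau> k) * (\<integral>\<omega>. (norm (\<eta> k \<omega>))\<^sup>2 \<partial>M)))"
    using moment by (intro ennreal_leI) auto
  also have "\<dots> = ennreal CARD('m)
      * ennreal (\<integral>\<omega>. (\<Sum>k<n. (\<tau> (Suc k) - \<tau> k) * (norm (\<eta> k \<omega>))\<^sup>2) \<partial>M)"
    using \<eta>_int by (subst Bochner_Integration.integral_sum) (simp_all add: ennreal_mult')
  also have "ennreal (\<integral>\<omega>. (\<Sum>k<n. (\<tau> (Suc k) - \<tau> k) * (norm (\<eta> k \<omega>))\<^sup>2) \<partial>M)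
      = (\<integral>\<^sup>+\<omega>. ennreal (\<Sum>k<n. (\<tau> (Suc k) - \<tau> k) * (norm (\<eta> k \<omega>))\<^sup>2) \<partial>M)"
    using \<eta>_int \<tau>(2)
    by (intro nn_integral_eq_integral[symmetric] AE_I2 sum_nonneg mult_nonneg_nonneg
        Bochner_Integration.integrable_sum) auto
  finally show ?thesis
    by (simp add: nn_integral_simple_value[OF \<tau>])
qed

section \<open>From simple integrands to general Ito integrals\<close>

lemma norm_square_le_diff:
  fixes x y :: "'a::real_normed_vector"
  shows "ennreal ((norm x)\<^sup>2) \<le> 2 * ennreal ((norm (y - x))\<^sup>2) + 2 * ennreal ((norm y)\<^sup>2)"
proof -
  have "(norm x)\<^sup>2 \<le> (norm (y - x) + norm y)\<^sup>2"
    using norm_triangle_ineq4[of y "y - x"] by (intro power_mono) (auto simp: norm_minus_commute)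
  also have "\<dots> \<le> 2 * (norm (y - x))\<^sup>2 + 2 * (norm y)\<^sup>2"
    using zero_le_power2[of "norm (y - x) - norm y"] by (simp add: power2_sum power2_diff)
  finally have "ennreal ((norm x)\<^sup>2) \<le> ennreal (2 * (norm (y - x))\<^sup>2 + 2 * (norm y)\<^sup>2)"
    by (rule ennreal_leI)
  then show ?thesis by (simp add: ennreal_mult')
qed

text \<open>Progressive measurability at the endpoint \<open>u = t\<close> is already joint
  measurability on \<open>[0, t]\<close>. Since \<open>F t\<close> is contained in \<open>M\<close>,
  extending by zero in time gives measurability on the full product, as needed for iterated
  integrals.\<close>

lemma L2_integrand_measurable:
  assumes "L2_integrand M F t H" "0 \<le> t" "subalgebra M (F t)"
  shows "(\<lambda>(\<omega>, s). indicator {0..t} s *\<^sub>R H s \<omega>) \<in> borel_measurable (M \<Otimes>\<^sub>M lborel)"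
proof -
  let ?P = "M \<Otimes>\<^sub>M (lborel :: real measure)" and ?Q = "space M \<times> {0..t}"
  have Q: "?Q \<in> sets ?P" by measurable
  have "(\<lambda>\<omega>. \<omega>) \<in> measurable M (F t)"
    by (rule measurable_from_subalg[OF assms(3) measurable_ident_sets]) simp
  then have "fst \<in> measurable (restrict_space ?P ?Q) (F t)"
    by (intro measurable_restrict_space1) (rule measurable_compose[OF measurable_fst])
  moreover have "snd \<in> measurable (restrict_space ?P ?Q) (restrict_space borel {0..t})"
    by (rule measurable_restrict_space2)
      (auto simp: space_restrict_space intro!: measurable_restrict_space1)
  ultimately have "(\<lambda>z. (snd z, fst z)) \<in>
      measurable (restrict_space ?P ?Q) (restrict_space borel {0..t} \<Otimes>\<^sub>M F t)"
    by (intro measurable_Pair)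
  moreover have "(\<lambda>(s, \<omega>). H s \<omega>) \<in> borel_measurable (restrict_space borel {0..t} \<Otimes>\<^sub>M F t)"
    using assms(1,2) by (simp add: L2_integrand_def)
  ultimately have "(\<lambda>z. H (snd z) (fst z)) \<in> borel_measurable (restrict_space ?P ?Q)"
    by (auto dest: measurable_compose)
  then have "(\<lambda>z. indicator ?Q z *\<^sub>R H (snd z) (fst z)) \<in> borel_measurable ?P"
    using Q by (subst (asm) borel_measurable_restrict_space_iff) (auto dest: sets.sets_into_space)
  then show ?thesis
    by (rule measurable_cong[THEN iffD1, rotated]) (auto simp: space_pair_measure indicator_def)
qed

text \<open>Of the factor 4, one factor 2 is lost in passing from \<open>I\<close> to an
  approximating integral, another in passing from the approximating integrand to \<open>H\<close>.
  The approximation errors vanish in the limit. Nonnegative integrals spare a separate finiteness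
  argument at each stage.\<close>

lemma has_ito_integral_second_moment:
  fixes W :: "real \<Rightarrow> 'w \<Rightarrow> real^'m" and H :: "real \<Rightarrow> 'w \<Rightarrow> real^'m^'d"
  assumes bm: "brownian_motion M W" and "0 \<le> t"
    and ito: "has_ito_integral M (augmented_filtration M W) W t H I"
  shows "(\<integral>\<^sup>+\<omega>. ennreal ((norm (I \<omega>))\<^sup>2) \<partial>M)
    \<le> ennreal (4 * CARD('m)) * (\<integral>\<^sup>+\<omega>. (\<integral>\<^sup>+s\<in>{0..t}. ennreal ((norm (H s \<omega>))\<^sup>2) \<partial>lborel) \<partial>M)"
proof -
  note meas = brownian_motion_measurable[OF bm]
  interpret prob_space M by (rule brownian_motion_prob_space[OF bm])
  let ?F = "augmented_filtration M W"
  let ?m = "ennreal CARD('m)"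
  have I_M: "I \<in> borel_measurable M" and L2: "L2_integrand M ?F t H"
    using ito by (auto simp: has_ito_integral_def)
  obtain n \<tau> \<eta> where simple: "\<And>l. simple_integrand M ?F t (n l) (\<tau> l) (\<eta> l)"
    and lim1: "(\<lambda>l. \<integral>\<^sup>+\<omega>. (\<integral>\<^sup>+s\<in>{0..t}.
            ennreal ((norm (simple_value (n l) (\<tau> l) (\<eta> l) s \<omega> - H s \<omega>))\<^sup>2) \<partial>lborel) \<partial>M) \<longlonglongrightarrow> 0"
    and lim2: "(\<lambda>l. \<integral>\<^sup>+\<omega>. ennreal ((norm (simple_integral W (n l) (\<tau> l) (\<eta> l) \<omega> - I \<omega>))\<^sup>2) \<partial>M)
          \<longlonglongrightarrow> 0"
    using ito unfolding has_ito_integral_def by blast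
  define S where "S l = simple_integral W (n l) (\<tau> l) (\<eta> l)" for l
  define V where "V l = simple_value (n l) (\<tau> l) (\<eta> l)" for l
  define A where "A l = (\<integral>\<^sup>+\<omega>. (\<integral>\<^sup>+s\<in>{0..t}. ennreal ((norm (V l s \<omega> - H s \<omega>))\<^sup>2) \<partial>lborel) \<partial>M)" for l
  define B where "B l = (\<integral>\<^sup>+\<omega>. ennreal ((norm (S l \<omega> - I \<omega>))\<^sup>2) \<partial>M)" for l
  define h where "h = (\<integral>\<^sup>+\<omega>. (\<integral>\<^sup>+s\<in>{0..t}. ennreal ((norm (H s \<omega>))\<^sup>2) \<partial>lborel) \<partial>M)"
  have [measurable]: "S l \<in> borel_measurable M" for l
    unfolding S_def using simple_integral_second_moment[OF bm simple[of l]]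
      measurable_from_subalg[OF subalgebra_augmented_filtration[OF meas]] by blast
  have H_meas [measurable]:
    "(\<lambda>(\<omega>, s). indicator {0..t} s *\<^sub>R H s \<omega>) \<in> borel_measurable (M \<Otimes>\<^sub>M lborel)"
    by (rule L2_integrand_measurable[OF L2 \<open>0 \<le> t\<close> subalgebra_augmented_filtration[OF meas]])
  have V_meas [measurable]: "(\<lambda>(\<omega>, s). V l s \<omega>) \<in> borel_measurable (M \<Otimes>\<^sub>M lborel)" for l
  proof -
    have "(\<lambda>z. indicator {\<tau> l k<..\<tau> l (Suc k)} (snd z) *\<^sub>R \<eta> l k (fst z))
        \<in> borel_measurable (M \<Otimes>\<^sub>M lborel)" if "k < n l" for k
    proof -
      have [measurable]: "\<eta> l k \<in> borel_measurable M"
        using simple[of l] that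
          measurable_from_subalg[OF subalgebra_augmented_filtration[OF meas]]
        unfolding simple_integrand_def by blast
      show ?thesis by measurable
    qed
    then show ?thesis
      unfolding V_def simple_value_def split_beta by (intro borel_measurable_sum) auto
  qed
  have I_le: "(\<integral>\<^sup>+\<omega>. ennreal ((norm (I \<omega>))\<^sup>2) \<partial>M) \<le> 2 * B l + 2 * (?m * (2 * A l + 2 * h))" for l
  proof -
    have "(\<integral>\<^sup>+\<omega>. ennreal ((norm (I \<omega>))\<^sup>2) \<partial>M)
        \<le> (\<integral>\<^sup>+\<omega>. 2 * ennreal ((norm (S l \<omega> - I \<omega>))\<^sup>2) + 2 * ennreal ((norm (S l \<omega>))\<^sup>2) \<partial>M)"
      by (intro nn_integral_mono norm_square_le_diff)
    also have "\<dots> = 2 * B l + 2 * (\<integral>\<^sup>+\<omega>. ennreal ((norm (S l \<omega>))\<^sup>2) \<partial>M)"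
      using I_M by (simp add: nn_integral_add nn_integral_cmult B_def)
    also have "(\<integral>\<^sup>+\<omega>. ennreal ((norm (S l \<omega>))\<^sup>2) \<partial>M)
        \<le> ?m * (\<integral>\<^sup>+\<omega>. (\<integral>\<^sup>+s\<in>{0..t}. ennreal ((norm (V l s \<omega>))\<^sup>2) \<partial>lborel) \<partial>M)"
      unfolding S_def V_def by (rule nn_integral_simple_integral_le[OF bm simple])
    also have "(\<integral>\<^sup>+\<omega>. (\<integral>\<^sup>+s\<in>{0..t}. ennreal ((norm (V l s \<omega>))\<^sup>2) \<partial>lborel) \<partial>M) \<le> 2 * A l + 2 * h"
    proof -
      \<comment> \<open>\<open>H\<close> is controlled on \<open>{0..t}\<close> only, so the
        indicator has to be multiplied in before the difference is formed.\<close>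
      have 1: "(\<lambda>(\<omega>, s). ennreal ((norm (V l s \<omega> - H s \<omega>))\<^sup>2) * indicator {0..t} s)
          \<in> borel_measurable (M \<Otimes>\<^sub>M lborel)"
      proof -
        have "(\<lambda>(\<omega>, s). ennreal ((norm (indicator {0..t} s *\<^sub>R V l s \<omega>
            - indicator {0..t} s *\<^sub>R H s \<omega>))\<^sup>2)) \<in> borel_measurable (M \<Otimes>\<^sub>M lborel)"
          by measurable
        then show ?thesis
          by (rule measurable_cong[THEN iffD1, rotated]) (auto simp: indicator_def)
      qed
      have 2: "(\<lambda>(\<omega>, s). ennreal ((norm (H s \<omega>))\<^sup>2) * indicator {0..t} s)
          \<in> borel_measurable (M \<Otimes>\<^sub>M lborel)"
      proof -
        have "(\<lambda>(\<omega>, s). ennreal ((norm (indicator {0..t} s *\<^sub>R H s \<omega>))\<^sup>2))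
            \<in> borel_measurable (M \<Otimes>\<^sub>M lborel)"
          by measurable
        then show ?thesis
          by (rule measurable_cong[THEN iffD1, rotated]) (auto simp: indicator_def)
      qed
      have "(\<integral>\<^sup>+\<omega>. (\<integral>\<^sup>+s\<in>{0..t}. ennreal ((norm (V l s \<omega>))\<^sup>2) \<partial>lborel) \<partial>M)
          \<le> (\<integral>\<^sup>+\<omega>. (\<integral>\<^sup>+s. 2 * (ennreal ((norm (V l s \<omega> - H s \<omega>))\<^sup>2) * indicator {0..t} s)
            + 2 * (ennreal ((norm (H s \<omega>))\<^sup>2) * indicator {0..t} s) \<partial>lborel) \<partial>M)"
      proof (intro nn_integral_mono)
        fix \<omega> s
        show "ennreal ((norm (V l s \<omega>))\<^sup>2) * indicator {0..t} s
            \<le> 2 * (ennreal ((norm (V l s \<omega> - H s \<omega>))\<^sup>2) * indicator {0..t} s)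
              + 2 * (ennreal ((norm (H s \<omega>))\<^sup>2) * indicator {0..t} s)"
          using norm_square_le_diff[of "V l s \<omega>" "H s \<omega>"]
          by (auto simp: indicator_def norm_minus_commute)
      qed
      also have "\<dots> = (\<integral>\<^sup>+\<omega>. 2 * (\<integral>\<^sup>+s\<in>{0..t}. ennreal ((norm (V l s \<omega> - H s \<omega>))\<^sup>2) \<partial>lborel)
            + 2 * (\<integral>\<^sup>+s\<in>{0..t}. ennreal ((norm (H s \<omega>))\<^sup>2) \<partial>lborel) \<partial>M)"
      proof (intro nn_integral_cong)
        fix \<omega> assume \<omega>: "\<omega> \<in> space M"
        have "(\<lambda>s. ennreal ((norm (V l s \<omega> - H s \<omega>))\<^sup>2) * indicator {0..t} s) \<in> borel_measurable lborel"
          using measurable_compose[OF measurable_Pair1'[OF \<omega>] 1] by simp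
        moreover have "(\<lambda>s. ennreal ((norm (H s \<omega>))\<^sup>2) * indicator {0..t} s) \<in> borel_measurable lborel"
          using measurable_compose[OF measurable_Pair1'[OF \<omega>] 2] by simp
        ultimately show "(\<integral>\<^sup>+s. 2 * (ennreal ((norm (V l s \<omega> - H s \<omega>))\<^sup>2) * indicator {0..t} s)
            + 2 * (ennreal ((norm (H s \<omega>))\<^sup>2) * indicator {0..t} s) \<partial>lborel)
          = 2 * (\<integral>\<^sup>+s\<in>{0..t}. ennreal ((norm (V l s \<omega> - H s \<omega>))\<^sup>2) \<partial>lborel)
            + 2 * (\<integral>\<^sup>+s\<in>{0..t}. ennreal ((norm (H s \<omega>))\<^sup>2) \<partial>lborel)"
          by (subst nn_integral_add) (auto simp: nn_integral_cmult intro!: borel_measurable_times)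
      qed
      also have "\<dots> = 2 * A l + 2 * h"
        using lborel.borel_measurable_nn_integral[OF 1] lborel.borel_measurable_nn_integral[OF 2]
        unfolding A_def h_def
        by (subst nn_integral_add) (auto simp: nn_integral_cmult intro!: borel_measurable_times)
      finally show ?thesis .
    qed
    finally show ?thesis by (simp add: mult_left_mono add_left_mono)
  qed
  have "(\<lambda>l. 2 * B l + 2 * (?m * (2 * A l + 2 * h))) \<longlonglongrightarrow> 2 * 0 + 2 * (?m * (2 * 0 + 2 * h))"
    using lim1 lim2 unfolding A_def B_def V_def S_def
    by (intro tendsto_add ennreal_tendsto_cmult tendsto_const) auto
  then have "(\<integral>\<^sup>+\<omega>. ennreal ((norm (I \<omega>))\<^sup>2) \<partial>M) \<le> 2 * 0 + 2 * (?m * (2 * 0 + 2 * h))"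
    by (rule LIMSEQ_le_const) (use I_le in auto)
  also have "\<dots> = ennreal (4 * CARD('m)) * h"
    by (simp add: ennreal_mult' mult_ac)
  finally show ?thesis by (simp add: h_def)
qed

section \<open>Second moments of solutions\<close>

text \<open>Gronwall yields the time integral of the squared norm. The moment at the final time then
  follows by inserting this into the inequality at \<open>t = T\<close>.\<close>

lemma sde_solution_square_integrable:
  fixes W :: "real \<Rightarrow> 'w \<Rightarrow> real^'m" and X :: "real \<Rightarrow> 'w \<Rightarrow> real^'d"
  assumes bm: "brownian_motion M W" and "0 \<le> T"
    and sol: "sde_solution M W T \<xi> \<beta> \<gamma> X"
    and cont: "continuous_on ({0..T} \<times> UNIV) (\<lambda>(t, x). \<beta> t x)"
    and growth: "\<And>t x. t \<in> {0..T} \<Longrightarrow> norm (\<beta> t x) \<le> c * (1 + norm x)"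
  shows "integrable M (\<lambda>\<omega>. LINT t:{0..T}|lborel. (norm (X t \<omega>))\<^sup>2)"
    and "integrable M (\<lambda>\<omega>. (norm (X T \<omega>))\<^sup>2)"
proof -
  note meas = brownian_motion_measurable[OF bm]
  interpret prob_space M by (rule brownian_motion_prob_space[OF bm])
  let ?F = "augmented_filtration M W" and ?H = "\<lambda>s \<omega>. \<gamma> s (X s \<omega>)"
  have "0 \<le> norm (\<beta> 0 0)" by simp
  also have "\<dots> \<le> c" using growth[of 0 0] \<open>0 \<le> T\<close> by simp
  finally have "0 \<le> c" .
  have X_M: "X t \<in> borel_measurable M" if "t \<in> {0..T}" for t
    using sol that measurable_from_subalg[OF subalgebra_augmented_filtration[OF meas]]
    unfolding sde_solution_def by blast
  have X_cont: "continuous_on {0..T} (\<lambda>t. X t \<omega>)" if "\<omega> \<in> space M" for \<omega>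
    using sol that by (simp add: sde_solution_def)
  have X2_M: "(\<lambda>\<omega>. (norm (X t \<omega>))\<^sup>2) \<in> borel_measurable M" if "t \<in> {0..T}" for t
    using X_M[OF that] by measurable
  have X2_cont: "continuous_on {0..T} (\<lambda>t. (norm (X t \<omega>))\<^sup>2)" if "\<omega> \<in> space M" for \<omega>
    by (intro continuous_intros X_cont[OF that])
  \<comment> \<open>Finite because the solution concept, read at time \<open>T\<close>, requires the
    diffusion coefficient along the state to be a square-integrable integrand.\<close>
  define h where "h = (\<integral>\<^sup>+\<omega>. (\<integral>\<^sup>+s\<in>{0..T}. ennreal ((norm (?H s \<omega>))\<^sup>2) \<partial>lborel) \<partial>M)"
  have "h < \<infinity>"
    using sol \<open>0 \<le> T\<close> unfolding h_def sde_solution_def has_ito_integral_def L2_integrand_def by auto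
  define C where "C = 4 * CARD('m) * enn2real h"
  have C: "ennreal (4 * CARD('m)) * h = ennreal C" "0 \<le> C"
    using \<open>h < \<infinity>\<close> by (simp_all add: C_def ennreal_mult' less_top)
  \<comment> \<open>The square of a sum of three terms costs a factor 3. Hence \<open>a\<close> and
    \<open>b\<close> contain three times the two constants of the estimate \<open>drift\<close>, and
    \<open>a\<close> in addition three times the squared initial value.\<close>
  define a where "a = 3 * (norm \<xi>)\<^sup>2 + 6 * c\<^sup>2 * T\<^sup>2"
  define b where "b = 6 * c\<^sup>2 * T"
  have drift: "(norm (LINT s:{0..t}|lborel. \<beta> s (X s \<omega>)))\<^sup>2
      \<le> 2 * c\<^sup>2 * T\<^sup>2 + 2 * c\<^sup>2 * T * (LINT s:{0..t}|lborel. (norm (X s \<omega>))\<^sup>2)"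
    if \<omega>: "\<omega> \<in> space M" and t: "t \<in> {0..T}" for t \<omega>
  proof -
    have t': "{0..t} \<subseteq> {0..T}" "0 \<le> t" "t \<le> T" using t by auto
    note X_cont' = continuous_on_subset[OF X_cont[OF \<omega>] t'(1)]
    have graph: "(\<lambda>s. (s, X s \<omega>)) ` {0..t} \<subseteq> {0..T} \<times> UNIV"
      using t'(1) by auto
    have \<beta>_cont: "continuous_on {0..t} (\<lambda>s. \<beta> s (X s \<omega>))"
      using continuous_on_compose2[OF cont continuous_on_Pair[OF continuous_on_id X_cont'] graph]
      by simp
    define g where "g s = c * (1 + norm (X s \<omega>))" for s
    have g_cont: "continuous_on {0..t} g"
      unfolding g_def by (intro continuous_intros X_cont')
    have "norm (integral {0..t} (\<lambda>s. \<beta> s (X s \<omega>))) \<le> integral {0..t} g"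
      using growth t'
      by (intro integral_norm_bound_integral integrable_continuous_real \<beta>_cont g_cont)
        (auto simp: g_def)
    then have "(norm (integral {0..t} (\<lambda>s. \<beta> s (X s \<omega>))))\<^sup>2 \<le> (integral {0..t} g)\<^sup>2"
      by (intro power_mono) auto
    also have "\<dots> \<le> t * integral {0..t} (\<lambda>s. (g s)\<^sup>2)"
      by (rule integral_square_le[OF g_cont \<open>0 \<le> t\<close>])
    also have "\<dots> \<le> T * integral {0..t} (\<lambda>s. (g s)\<^sup>2)"
      using t' by (intro mult_right_mono integral_nonneg)
        (auto intro!: integrable_continuous_real continuous_intros g_cont)
    also have "integral {0..t} (\<lambda>s. (g s)\<^sup>2)
        \<le> integral {0..t} (\<lambda>s. 2 * c\<^sup>2 + 2 * c\<^sup>2 * (norm (X s \<omega>))\<^sup>2)"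
    proof (rule integral_le)
      show "(g s)\<^sup>2 \<le> 2 * c\<^sup>2 + 2 * c\<^sup>2 * (norm (X s \<omega>))\<^sup>2" for s
      proof -
        have "(1 + norm (X s \<omega>))\<^sup>2 \<le> 2 + 2 * (norm (X s \<omega>))\<^sup>2"
          using zero_le_power2[of "1 - norm (X s \<omega>)"] by (simp add: power2_sum power2_diff)
        then have "c\<^sup>2 * (1 + norm (X s \<omega>))\<^sup>2 \<le> c\<^sup>2 * (2 + 2 * (norm (X s \<omega>))\<^sup>2)"
          by (rule mult_left_mono) simp
        also have "\<dots> = 2 * c\<^sup>2 + 2 * c\<^sup>2 * (norm (X s \<omega>))\<^sup>2"
          by (simp add: algebra_simps)
        finally show ?thesis by (simp only: g_def power_mult_distrib)
      qed
    qed (auto intro!: integrable_continuous_real continuous_intros g_cont X_cont')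
    also have "\<dots> = 2 * c\<^sup>2 * t + 2 * c\<^sup>2 * integral {0..t} (\<lambda>s. (norm (X s \<omega>))\<^sup>2)"
      using t' by (subst integral_add)
        (auto intro!: integrable_continuous_real continuous_intros X_cont')
    also have "2 * c\<^sup>2 * t \<le> 2 * c\<^sup>2 * T"
      using t' by (intro mult_left_mono) auto
    finally have "(norm (integral {0..t} (\<lambda>s. \<beta> s (X s \<omega>))))\<^sup>2
        \<le> T * (2 * c\<^sup>2 * T + 2 * c\<^sup>2 * integral {0..t} (\<lambda>s. (norm (X s \<omega>))\<^sup>2))"
      using \<open>0 \<le> T\<close> by (simp add: mult_left_mono)
    then show ?thesis
      using LINT_eq_integral[OF \<beta>_cont]
        LINT_eq_integral[OF continuous_on_subset[OF X2_cont[OF \<omega>] t'(1)]]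
      by (simp add: distrib_left power2_eq_square mult_ac)
  qed
  \<comment> \<open>Measurability of \<open>Z\<close> is recorded beyond what Gronwall asks for,
    because at the final time \<open>Z\<close> has to be integrable itself.\<close>
  have bound: "\<exists>Z. Z \<in> borel_measurable M \<and> (\<forall>\<omega>. 0 \<le> Z \<omega>) \<and>
      (AE \<omega> in M. (norm (X t \<omega>))\<^sup>2 \<le> Z \<omega> + b * (LINT s:{0..t}|lborel. (norm (X s \<omega>))\<^sup>2)) \<and>
      (\<integral>\<^sup>+\<omega>. ennreal (Z \<omega>) \<partial>M) \<le> ennreal (a + 3 * C)" if t: "t \<in> {0..T}" for t
  proof -
    obtain I where ito: "has_ito_integral M ?F W t ?H I"
      and eq: "AE \<omega> in M. X t \<omega> = \<xi> + (LINT s:{0..t}|lborel. \<beta> s (X s \<omega>)) + I \<omega>"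
      using sol t unfolding sde_solution_def by blast
    have I_M: "I \<in> borel_measurable M" using ito by (simp add: has_ito_integral_def)
    \<comment> \<open>The Ito term stays inside \<open>Z\<close>. Its second moment is bounded
      through the integrand on all of \<open>[0, T]\<close>, so that one constant \<open>C\<close>
      serves every \<open>t\<close>.\<close>
    define Z where "Z \<omega> = a + 3 * (norm (I \<omega>))\<^sup>2" for \<omega>
    have "0 \<le> a" using \<open>0 \<le> T\<close> by (simp add: a_def)
    have "AE \<omega> in M. (norm (X t \<omega>))\<^sup>2 \<le> Z \<omega> + b * (LINT s:{0..t}|lborel. (norm (X s \<omega>))\<^sup>2)"
      using eq AE_space
    proof eventually_elim
      case (elim \<omega>)
      define x y z where "x = norm \<xi>" and "y = norm (LINT s:{0..t}|lborel. \<beta> s (X s \<omega>))"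
        and "z = norm (I \<omega>)"
      have "norm (X t \<omega>) \<le> x + y + z"
        unfolding elim(1) x_def y_def z_def by (intro norm_triangle_mono order_refl)
      then have "(norm (X t \<omega>))\<^sup>2 \<le> (x + y + z)\<^sup>2"
        by (rule power_mono) simp
      also have "\<dots> \<le> 3 * x\<^sup>2 + 3 * y\<^sup>2 + 3 * z\<^sup>2"
        using zero_le_power2[of "x - y"] zero_le_power2[of "x - z"] zero_le_power2[of "y - z"]
        by (simp add: power2_eq_square algebra_simps)
      finally show ?case
        using drift[OF elim(2) t] by (simp add: Z_def a_def b_def x_def y_def z_def)
    qed
    moreover have "(\<integral>\<^sup>+\<omega>. ennreal (Z \<omega>) \<partial>M) \<le> ennreal (a + 3 * C)"
    proof -
      have "(\<integral>\<^sup>+\<omega>. (\<integral>\<^sup>+s\<in>{0..t}. ennreal ((norm (?H s \<omega>))\<^sup>2) \<partial>lborel) \<partial>M) \<le> h"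
        unfolding h_def using t by (intro nn_integral_mono mult_left_mono) (auto simp: indicator_def)
      then have "(\<integral>\<^sup>+\<omega>. ennreal ((norm (I \<omega>))\<^sup>2) \<partial>M) \<le> ennreal C"
        using has_ito_integral_second_moment[OF bm _ ito] t unfolding C(1)[symmetric]
        by (elim order_trans[rotated, OF mult_left_mono]) auto
      then have "ennreal a + 3 * (\<integral>\<^sup>+\<omega>. ennreal ((norm (I \<omega>))\<^sup>2) \<partial>M) \<le> ennreal a + 3 * ennreal C"
        by (intro add_left_mono mult_left_mono) auto
      moreover have "(\<integral>\<^sup>+\<omega>. ennreal (Z \<omega>) \<partial>M) = ennreal a + 3 * (\<integral>\<^sup>+\<omega>. ennreal ((norm (I \<omega>))\<^sup>2) \<partial>M)"
        using I_M \<open>0 \<le> a\<close>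
        by (simp add: Z_def ennreal_mult' nn_integral_add nn_integral_cmult emeasure_space_1)
      ultimately show ?thesis
        using \<open>0 \<le> a\<close> \<open>0 \<le> C\<close> by (simp add: ennreal_mult')
    qed
    moreover have "Z \<in> borel_measurable M" using I_M unfolding Z_def by measurable
    ultimately show ?thesis using \<open>0 \<le> a\<close> by (intro exI[of _ Z]) (auto simp: Z_def)
  qed
  have "0 \<le> b" using \<open>0 \<le> T\<close> by (simp add: b_def)
  show int: "integrable M (\<lambda>\<omega>. LINT t:{0..T}|lborel. (norm (X t \<omega>))\<^sup>2)"
  proof (rule gronwall_expectation[OF sigma_finite_measure_axioms \<open>0 \<le> T\<close> \<open>0 \<le> b\<close> X2_M X2_cont])
    show "\<exists>Z. (\<forall>\<omega>. 0 \<le> Z \<omega>) \<and>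
      (AE \<omega> in M. (norm (X t \<omega>))\<^sup>2 \<le> Z \<omega> + b * (LINT s:{0..t}|lborel. (norm (X s \<omega>))\<^sup>2)) \<and>
      (\<integral>\<^sup>+\<omega>. ennreal (Z \<omega>) \<partial>M) \<le> ennreal (a + 3 * C)" if "t \<in> {0..T}" for t
      using bound[OF that] by blast
  qed simp_all
  \<comment> \<open>At time \<open>T\<close> the time integral on the right is now known to be
    integrable, so the right-hand side is an integrable majorant.\<close>
  obtain Z where Z: "Z \<in> borel_measurable M" "\<And>\<omega>. 0 \<le> Z \<omega>"
      "AE \<omega> in M. (norm (X T \<omega>))\<^sup>2 \<le> Z \<omega> + b * (LINT s:{0..T}|lborel. (norm (X s \<omega>))\<^sup>2)"
      "(\<integral>\<^sup>+\<omega>. ennreal (Z \<omega>) \<partial>M) \<le> ennreal (a + 3 * C)"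
    using bound[of T] \<open>0 \<le> T\<close> by auto
  have "integrable M Z"
    using Z by (intro integrableI_nonneg) (auto intro: le_less_trans)
  then have "integrable M (\<lambda>\<omega>. Z \<omega> + b * (LINT s:{0..T}|lborel. (norm (X s \<omega>))\<^sup>2))"
    using int by simp
  then show "integrable M (\<lambda>\<omega>. (norm (X T \<omega>))\<^sup>2)"
  proof (rule Bochner_Integration.integrable_bound)
    show "(\<lambda>\<omega>. (norm (X T \<omega>))\<^sup>2) \<in> borel_measurable M"
      using \<open>0 \<le> T\<close> by (intro X2_M) auto
    show "AE \<omega> in M. norm ((norm (X T \<omega>))\<^sup>2)
        \<le> norm (Z \<omega> + b * (LINT s:{0..T}|lborel. (norm (X s \<omega>))\<^sup>2))"
      using Z(3) by eventually_elim auto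
  qed
qed

text \<open>Comparison with the fixed point \<open>(0, a0)\<close>: boundedness of \<open>A\<close>
  keeps the action part of the distance below a constant, so only \<open>norm x\<close> can grow.
  The constant \<open>c\<close> is chosen to dominate both the intercept and the slope
  \<open>L\<close>.\<close>

lemma lipschitz_linear_growth:
  fixes f :: "'a::real_normed_vector \<Rightarrow> 'b::real_normed_vector \<Rightarrow> 'c::real_normed_vector"
  assumes "L-lipschitz_on (UNIV \<times> A) (\<lambda>(x, a). f x a)" and "bounded A"
  shows "\<exists>c. \<forall>x. \<forall>a\<in>A. norm (f x a) \<le> c * (1 + norm x)"
proof (cases "A = {}")
  case False
  then obtain a0 where a0: "a0 \<in> A" by blast
  obtain B where B: "\<And>a. a \<in> A \<Longrightarrow> dist a a0 \<le> B"
    using \<open>bounded A\<close> bounded_any_center[of A a0] by (auto simp: dist_commute)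
  have "0 \<le> B" using B[OF a0] by simp
  have "0 \<le> L" by (rule lipschitz_on_nonneg[OF assms(1)])
  define c where "c = norm (f 0 a0) + L * B + L"
  have "norm (f x a) \<le> c * (1 + norm x)" if "a \<in> A" for x a
  proof -
    have "dist (f x a) (f 0 a0) \<le> L * dist (x, a) (0, a0)"
      using lipschitz_onD[OF assms(1), of "(x, a)" "(0, a0)"] that a0 by simp
    also have "dist (x, a) (0, a0) \<le> norm x + B"
      using sqrt_sum_squares_le_sum[of "dist x 0" "dist a a0"] B[OF that] by (simp add: dist_Pair_Pair)
    finally have "dist (f x a) (f 0 a0) \<le> L * (norm x + B)"
      using \<open>0 \<le> L\<close> by (simp add: mult_left_mono)
    then have "norm (f x a) \<le> norm (f 0 a0) + L * B + L * norm x"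
      using norm_triangle_ineq2[of "f x a" "f 0 a0"] by (simp add: dist_norm distrib_left)
    also have "\<dots> \<le> c + c * norm x"
      using \<open>0 \<le> L\<close> \<open>0 \<le> B\<close> by (intro add_mono mult_right_mono) (auto simp: c_def)
    finally show ?thesis by (simp add: distrib_left)
  qed
  then show ?thesis by blast
qed simp

text \<open>Off-diagonal index pairs are those with \<open>i < j\<close> together with their mirror
  images. This links the costs, which sum over opponents, to the potential, which counts each pair
  once.\<close>

lemma sum_ordered_pairs:
  fixes f :: "nat \<Rightarrow> nat \<Rightarrow> 'a::comm_monoid_add"
  shows "(\<Sum>i\<in>{1..n}. \<Sum>j\<in>{1..n} - {i}. f i j)
    = (\<Sum>(i, j)\<in>{(i, j). 1 \<le> i \<and> i < j \<and> j \<le> n}. f i j + f j i)"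
proof -
  let ?A = "{(i, j). 1 \<le> i \<and> i < j \<and> j \<le> n}"
  have fin: "finite ?A" by (rule finite_subset[of _ "{1..n} \<times> {1..n}"]) auto
  have "(\<Sum>i\<in>{1..n}. \<Sum>j\<in>{1..n} - {i}. f i j) = (\<Sum>(i, j)\<in>(SIGMA i:{1..n}. {1..n} - {i}). f i j)"
    by (rule sum.Sigma) auto
  also have "(SIGMA i:{1..n}. {1..n} - {i}) = ?A \<union> prod.swap ` ?A"
    by (auto simp: image_iff prod.swap_def)
  also have "(\<Sum>(i, j)\<in>?A \<union> prod.swap ` ?A. f i j)
      = (\<Sum>(i, j)\<in>?A. f i j) + (\<Sum>(i, j)\<in>prod.swap ` ?A. f i j)"
    using fin by (intro sum.union_disjoint) auto
  also have "(\<Sum>(i, j)\<in>prod.swap ` ?A. f i j) = (\<Sum>(i, j)\<in>?A. f j i)"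
    by (subst sum.reindex) (auto simp: inj_on_def split_beta)
  also have "(\<Sum>(i, j)\<in>?A. f i j) + (\<Sum>(i, j)\<in>?A. f j i) = (\<Sum>(i, j)\<in>?A. f i j + f j i)"
    by (simp add: sum.distrib[symmetric] split_beta del: mem_Collect_eq)
  finally show ?thesis .
qed

section \<open>The game\<close>

locale game_states =
  fixes G :: "('w, 'd::finite, 'k::finite, 'm::finite) game"
    and X :: "('w, 'd, 'k) states"
  assumes game: "markov_game G" and states: "state_processes G X"
begin

abbreviation "N \<equiv> nplayers G"
abbreviation "M \<equiv> base G"
abbreviation "T \<equiv> horizon G"

abbreviation "pairs \<equiv> {(i, j). 1 \<le> i \<and> i < j \<and> j \<le> N}"

sublocale prob_space M
  using game by (simp add: markov_game_def)

lemma horizon_nonneg: "0 \<le> T"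
  using game by (simp add: markov_game_def)

lemma finite_players [simp]: "finite (players G)"
  by (simp add: players_def)

lemma weight_nonneg: "i \<in> players G \<Longrightarrow> j \<in> players G \<Longrightarrow> i \<noteq> j \<Longrightarrow> 0 \<le> weight G i j"
  using game by (simp add: markov_game_def)

lemma policy_continuous:
  assumes "i \<in> players G" "\<psi> \<in> policies G i"
  shows "continuous_on ({0..T} \<times> UNIV) \<psi>"
  using assms game unfolding markov_game_def admissible_policies_def time_space_def by blast

lemma policy_actions:
  assumes "i \<in> players G" "\<psi> \<in> policies G i" "t \<in> {0..T}"
  shows "\<psi> (t, x) \<in> actions G i"
proof -
  have "\<psi> ` ({0..T} \<times> UNIV) \<subseteq> actions G i"
    using assms game unfolding markov_game_def admissible_policies_def time_space_def by blast
  then show ?thesis using assms(3) by auto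
qed

text \<open>Serves both the drift and the running cost. These are continuous only over the action
  set, so it matters that policies take their values there.\<close>

lemma feedback_continuous:
  assumes i: "i \<in> players G" "\<psi> \<in> policies G i"
    and f: "continuous_on (UNIV \<times> actions G i) (\<lambda>(x, a). f x a)"
  shows "continuous_on ({0..T} \<times> UNIV) (\<lambda>(t, x). f x (\<psi> (t, x)))"
proof -
  have sub: "(\<lambda>z. (snd z, \<psi> z)) ` ({0..T} \<times> UNIV) \<subseteq> UNIV \<times> actions G i"
    using policy_actions[OF i] by auto
  have "continuous_on ({0..T} \<times> UNIV) (\<lambda>z. (snd z, \<psi> z))"
    by (intro continuous_intros policy_continuous[OF i])
  from continuous_on_compose2[OF f this sub] show ?thesis
    by (simp add: split_beta)
qed

lemma state_measurable:
  assumes "i \<in> players G" "\<psi> \<in> policies G i" "t \<in> {0..T}"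
  shows "X i \<psi> t \<in> borel_measurable M"
proof -
  have "brownian_motion M (noise G)" using game by (simp add: markov_game_def)
  moreover have "X i \<psi> t \<in> borel_measurable (augmented_filtration M (noise G) t)"
    using states assms unfolding state_processes_def sde_solution_def by blast
  ultimately show ?thesis
    by (metis measurable_from_subalg subalgebra_augmented_filtration brownian_motion_measurable)
qed

lemma state_continuous:
  assumes "i \<in> players G" "\<psi> \<in> policies G i" "\<omega> \<in> space M"
  shows "continuous_on {0..T} (\<lambda>t. X i \<psi> t \<omega>)"
  using states assms unfolding state_processes_def sde_solution_def by blast

lemma state_square_integrable:
  assumes i: "i \<in> players G" "\<psi> \<in> policies G i"
  shows "integrable M (\<lambda>\<omega>. LINT t:{0..T}|lborel. (norm (X i \<psi> t \<omega>))\<^sup>2)"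
    and "integrable M (\<lambda>\<omega>. (norm (X i \<psi> T \<omega>))\<^sup>2)"
proof -
  have bm: "brownian_motion M (noise G)" using game by (simp add: markov_game_def)
  have sol: "sde_solution M (noise G) T (init G i)
      (\<lambda>t x. drift G i x (\<psi> (t, x))) (\<lambda>t x. diffusion G i x (\<psi> (t, x))) (X i \<psi>)"
    using states i by (simp add: state_processes_def)
  have "\<exists>L. L-lipschitz_on (UNIV \<times> actions G i) (\<lambda>(x, a). drift G i x a)"
    and compact: "compact (actions G i)"
    using game i(1) by (simp_all add: markov_game_def)
  then obtain L where L: "L-lipschitz_on (UNIV \<times> actions G i) (\<lambda>(x, a). drift G i x a)"
    by blast
  obtain c where c: "\<And>x a. a \<in> actions G i \<Longrightarrow> norm (drift G i x a) \<le> c * (1 + norm x)"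
    using lipschitz_linear_growth[OF L compact_imp_bounded[OF compact]] by blast
  note cont = feedback_continuous[OF i lipschitz_on_continuous_on[OF L]]
  have growth: "norm (drift G i x (\<psi> (t, x))) \<le> c * (1 + norm x)" if "t \<in> {0..T}" for t x
    by (rule c[OF policy_actions[OF i that]])
  show "integrable M (\<lambda>\<omega>. LINT t:{0..T}|lborel. (norm (X i \<psi> t \<omega>))\<^sup>2)"
    and "integrable M (\<lambda>\<omega>. (norm (X i \<psi> T \<omega>))\<^sup>2)"
    using sde_solution_square_integrable[OF bm horizon_nonneg sol cont growth] by blast+
qed

lemma running_cost_integrable:
  assumes i: "i \<in> players G" "\<psi> \<in> policies G i"
  defines "F \<equiv> \<lambda>t \<omega>. running_cost G i (X i \<psi> t \<omega>) (\<psi> (t, X i \<psi> t \<omega>))"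
  shows "\<omega> \<in> space M \<Longrightarrow> set_integrable lborel {0..T} (\<lambda>t. F t \<omega>)"
    and "integrable M (\<lambda>\<omega>. LINT t:{0..T}|lborel. F t \<omega>)"
proof -
  have rc: "continuous_on (UNIV \<times> actions G i) (\<lambda>(x, a). running_cost G i x a)"
    using game i(1) by (simp add: markov_game_def)
  have "\<exists>c. \<forall>x. \<forall>a\<in>actions G i. \<bar>running_cost G i x a\<bar> \<le> c * (1 + (norm x)\<^sup>2)"
    using game i(1) by (simp add: markov_game_def)
  then obtain c where c: "\<And>x a. a \<in> actions G i \<Longrightarrow> \<bar>running_cost G i x a\<bar> \<le> c * (1 + (norm x)\<^sup>2)"
    by blast
  note cont = feedback_continuous[OF i rc]
  have F_cont: "continuous_on {0..T} (\<lambda>t. F t \<omega>)" if \<omega>: "\<omega> \<in> space M" for \<omega>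
  proof -
    have "(\<lambda>t. (t, X i \<psi> t \<omega>)) ` {0..T} \<subseteq> {0..T} \<times> UNIV" by auto
    from continuous_on_compose2[OF cont continuous_on_Pair[OF continuous_on_id
          state_continuous[OF i \<omega>]] this]
    show ?thesis by (simp add: F_def)
  qed
  have F_meas: "F t \<in> borel_measurable M" if t: "t \<in> {0..T}" for t
  proof -
    have "continuous_on UNIV (\<lambda>x. running_cost G i x (\<psi> (t, x)))"
      using continuous_on_compose2[OF cont, of UNIV "\<lambda>x. (t, x)"] t
      by (simp add: continuous_on_Pair image_subset_iff)
    then show ?thesis
      unfolding F_def
      by (intro measurable_compose[OF state_measurable[OF i t]] borel_measurable_continuous_onI)
  qed
  show F_int: "set_integrable lborel {0..T} (\<lambda>t. F t \<omega>)" if "\<omega> \<in> space M" for \<omega>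
    by (rule borel_integrable_atLeastAtMost'[OF F_cont[OF that]])
  \<comment> \<open>The majorant is the time integral of the quadratic growth bound;
    \<open>T\<close> is the contribution of its constant term.\<close>
  have "integrable M (\<lambda>\<omega>. c * (T + (LINT t:{0..T}|lborel. (norm (X i \<psi> t \<omega>))\<^sup>2)))"
    using state_square_integrable(1)[OF i] by simp
  then show "integrable M (\<lambda>\<omega>. LINT t:{0..T}|lborel. F t \<omega>)"
  proof (rule Bochner_Integration.integrable_bound)
    show "(\<lambda>\<omega>. LINT t:{0..T}|lborel. F t \<omega>) \<in> borel_measurable M"
      by (rule borel_measurable_time_integral[OF F_meas F_cont])
    show "AE \<omega> in M. norm (LINT t:{0..T}|lborel. F t \<omega>)
        \<le> norm (c * (T + (LINT t:{0..T}|lborel. (norm (X i \<psi> t \<omega>))\<^sup>2)))"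
    proof (rule AE_I2)
      fix \<omega> assume \<omega>: "\<omega> \<in> space M"
      have X2_cont: "continuous_on {0..T} (\<lambda>t. (norm (X i \<psi> t \<omega>))\<^sup>2)"
        by (intro continuous_intros state_continuous[OF i \<omega>])
      have "norm (integral {0..T} (\<lambda>t. F t \<omega>))
          \<le> integral {0..T} (\<lambda>t. c * (1 + (norm (X i \<psi> t \<omega>))\<^sup>2))"
        using c[OF policy_actions[OF i]]
        by (intro integral_norm_bound_integral integrable_continuous_real F_cont[OF \<omega>]
            continuous_intros state_continuous[OF i \<omega>]) (simp add: F_def)
      also have "\<dots> = c * (T + integral {0..T} (\<lambda>t. (norm (X i \<psi> t \<omega>))\<^sup>2))"
        using horizon_nonneg integrable_continuous_real[OF X2_cont]
        by (simp add: Henstock_Kurzweil_Integration.integral_add integrable_const_ivl)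
      finally show "norm (LINT t:{0..T}|lborel. F t \<omega>)
          \<le> norm (c * (T + (LINT t:{0..T}|lborel. (norm (X i \<psi> t \<omega>))\<^sup>2)))"
        unfolding LINT_eq_integral[OF F_cont[OF \<omega>]] LINT_eq_integral[OF X2_cont]
        by simp
    qed
  qed
qed

lemma terminal_cost_integrable:
  assumes i: "i \<in> players G" "\<psi> \<in> policies G i"
  shows "integrable M (\<lambda>\<omega>. terminal_cost G i (X i \<psi> T \<omega>))"
proof -
  have cont: "continuous_on UNIV (terminal_cost G i)"
    using game i(1) by (simp add: markov_game_def)
  have "\<exists>c. \<forall>x. \<bar>terminal_cost G i x\<bar> \<le> c * (1 + (norm x)\<^sup>2)"
    using game i(1) by (simp add: markov_game_def)
  then obtain c where c: "\<And>x. \<bar>terminal_cost G i x\<bar> \<le> c * (1 + (norm x)\<^sup>2)"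
    by blast
  have "integrable M (\<lambda>\<omega>. c * (1 + (norm (X i \<psi> T \<omega>))\<^sup>2))"
    using state_square_integrable(2)[OF i] by simp
  then show ?thesis
  proof (rule Bochner_Integration.integrable_bound)
    show "(\<lambda>\<omega>. terminal_cost G i (X i \<psi> T \<omega>)) \<in> borel_measurable M"
      using horizon_nonneg
      by (intro measurable_compose[OF state_measurable[OF i]] borel_measurable_continuous_onI cont) auto
    show "AE \<omega> in M. norm (terminal_cost G i (X i \<psi> T \<omega>)) \<le> norm (c * (1 + (norm (X i \<psi> T \<omega>))\<^sup>2))"
      using c by (intro AE_I2) (metis abs_ge_self order_trans real_norm_def)
  qed
qed

lemma kernel_integrable:
  assumes i: "i \<in> players G" "\<psi> \<in> policies G i" and j: "j \<in> players G" "\<psi>' \<in> policies G j"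
  defines "F \<equiv> \<lambda>t \<omega>. kernel G (X i \<psi> t \<omega> - X j \<psi>' t \<omega>)"
  shows "\<omega> \<in> space M \<Longrightarrow> set_integrable lborel {0..T} (\<lambda>t. F t \<omega>)"
    and "integrable M (\<lambda>\<omega>. LINT t:{0..T}|lborel. F t \<omega>)"
proof -
  have cont: "continuous_on UNIV (kernel G)" and "bounded (range (kernel G))"
    using game by (simp_all add: markov_game_def)
  then obtain B where B: "\<And>x. \<bar>kernel G x\<bar> \<le> B"
    unfolding bounded_iff by auto
  have F_cont: "continuous_on {0..T} (\<lambda>t. F t \<omega>)" if \<omega>: "\<omega> \<in> space M" for \<omega>
    unfolding F_def using state_continuous[OF i \<omega>] state_continuous[OF j \<omega>]
    by (intro continuous_on_compose2[OF cont]) (auto intro!: continuous_intros)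
  have F_meas: "F t \<in> borel_measurable M" if t: "t \<in> {0..T}" for t
    unfolding F_def using state_measurable[OF i t] state_measurable[OF j t]
    by (intro measurable_compose[OF borel_measurable_diff] borel_measurable_continuous_onI cont)
  show "set_integrable lborel {0..T} (\<lambda>t. F t \<omega>)" if "\<omega> \<in> space M" for \<omega>
    by (rule borel_integrable_atLeastAtMost'[OF F_cont[OF that]])
  show "integrable M (\<lambda>\<omega>. LINT t:{0..T}|lborel. F t \<omega>)"
  proof (rule integrable_const_bound)
    show "(\<lambda>\<omega>. LINT t:{0..T}|lborel. F t \<omega>) \<in> borel_measurable M"
      by (rule borel_measurable_time_integral[OF F_meas F_cont])
    show "AE \<omega> in M. norm (LINT t:{0..T}|lborel. F t \<omega>) \<le> B * (T - 0)"
    proof (rule AE_I2)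
      fix \<omega> assume \<omega>: "\<omega> \<in> space M"
      show "norm (LINT t:{0..T}|lborel. F t \<omega>) \<le> B * (T - 0)"
        unfolding LINT_eq_integral[OF F_cont[OF \<omega>]]
        by (rule integral_bound[OF horizon_nonneg F_cont[OF \<omega>]]) (simp add: F_def B)
    qed
  qed
qed

section \<open>Costs as sums over players and pairs\<close>

lemma profile_policy: "\<phi> \<in> profiles G \<Longrightarrow> i \<in> players G \<Longrightarrow> \<phi> i \<in> policies G i"
  by (auto simp: profiles_def)

text \<open>Linearity is used twice: in time on each path, where continuity provides integrability,
  and in expectation, where the second moments and the boundedness of the kernel do.\<close>

lemma cost_decomposition:
  assumes \<phi>: "\<phi> \<in> profiles G" and i: "i \<in> players G"
  shows "cost G X i \<phi> = own_cost G X i \<phi>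
    + (\<Sum>j\<in>players G - {i}. weight G i j * interaction G X i j \<phi>)"
proof -
  define F where "F t \<omega> = running_cost G i (X i (\<phi> i) t \<omega>) (\<phi> i (t, X i (\<phi> i) t \<omega>))" for t \<omega>
  define R where "R j t \<omega> = kernel G (X i (\<phi> i) t \<omega> - X j (\<phi> j) t \<omega>)" for j t \<omega>
  let ?g = "\<lambda>\<omega>. terminal_cost G i (X i (\<phi> i) T \<omega>)"
  note pol = profile_policy[OF \<phi>]
  note F = running_cost_integrable[OF i pol[OF i], folded F_def]
  have R: "\<omega> \<in> space M \<Longrightarrow> set_integrable lborel {0..T} (\<lambda>t. R j t \<omega>)"
    "integrable M (\<lambda>\<omega>. LINT t:{0..T}|lborel. R j t \<omega>)" if "j \<in> players G - {i}" for j \<omega>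
    using kernel_integrable[OF i pol[OF i], of j "\<phi> j"] that pol[of j] unfolding R_def by auto
  note g = terminal_cost_integrable[OF i pol[OF i]]
  have split: "(LINT t:{0..T}|lborel. F t \<omega> + (\<Sum>j\<in>players G - {i}. weight G i j * R j t \<omega>))
      = (LINT t:{0..T}|lborel. F t \<omega>)
        + (\<Sum>j\<in>players G - {i}. weight G i j * (LINT t:{0..T}|lborel. R j t \<omega>))"
    if \<omega>: "\<omega> \<in> space M" for \<omega>
  proof -
    have Rw: "integrable lborel (\<lambda>t. indicator {0..T} t *\<^sub>R (weight G i j * R j t \<omega>))"
      if "j \<in> players G - {i}" for j
      using set_integrable_mult_right[of "weight G i j" lborel "{0..T}" "\<lambda>t. R j t \<omega>"] R(1)[OF that \<omega>]
      by (simp add: set_integrable_def)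
    have sum: "set_integrable lborel {0..T} (\<lambda>t. \<Sum>j\<in>players G - {i}. weight G i j * R j t \<omega>)"
      unfolding set_integrable_def scaleR_sum_right
      by (rule Bochner_Integration.integrable_sum[OF Rw])
    have "(LINT t:{0..T}|lborel. (\<Sum>j\<in>players G - {i}. weight G i j * R j t \<omega>))
        = (\<Sum>j\<in>players G - {i}. LINT t:{0..T}|lborel. weight G i j * R j t \<omega>)"
      unfolding set_lebesgue_integral_def scaleR_sum_right
      by (rule Bochner_Integration.integral_sum[OF Rw])
    then show ?thesis
      using set_integral_add(2)[OF F(1)[OF \<omega>] sum] by simp
  qed
  have "cost G X i \<phi> = (\<integral>\<omega>. ((LINT t:{0..T}|lborel. F t \<omega>) + ?g \<omega>)
      + (\<Sum>j\<in>players G - {i}. weight G i j * (LINT t:{0..T}|lborel. R j t \<omega>)) \<partial>M)"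
    unfolding cost_def
    by (rule Bochner_Integration.integral_cong[OF refl])
      (simp add: split[unfolded F_def R_def] F_def R_def)
  also have "\<dots> = own_cost G X i \<phi>
      + (\<integral>\<omega>. (\<Sum>j\<in>players G - {i}. weight G i j * (LINT t:{0..T}|lborel. R j t \<omega>)) \<partial>M)"
    unfolding own_cost_def F_def[symmetric]
    using F(2) g R(2)
    by (intro Bochner_Integration.integral_add Bochner_Integration.integrable_add
        Bochner_Integration.integrable_sum integrable_mult_right) auto
  also have "(\<integral>\<omega>. (\<Sum>j\<in>players G - {i}. weight G i j * (LINT t:{0..T}|lborel. R j t \<omega>)) \<partial>M)
      = (\<Sum>j\<in>players G - {i}. weight G i j * interaction G X i j \<phi>)"
    unfolding interaction_def R_def[symmetric]
    using R(2) by (subst Bochner_Integration.integral_sum) auto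
  finally show ?thesis .
qed

text \<open>Evenness of the kernel makes the interaction one quantity per pair, seen equally by both
  players; the pair coefficients below rest on this.\<close>

lemma interaction_commute: "interaction G X i j \<phi> = interaction G X j i \<phi>"
proof -
  have "kernel G (x - y) = kernel G (y - x)" for x y
    using game unfolding markov_game_def by (metis minus_diff_eq)
  then show ?thesis unfolding interaction_def by simp
qed

lemma social_cost_pairs:
  assumes "\<phi> \<in> profiles G"
  shows "social_cost G X \<phi> = (\<Sum>i\<in>players G. own_cost G X i \<phi>)
    + (\<Sum>(i, j)\<in>pairs. (weight G i j + weight G j i) * interaction G X i j \<phi>)"
proof -
  have "social_cost G X \<phi> = (\<Sum>i\<in>players G. own_cost G X i \<phi>)
      + (\<Sum>i\<in>{1..N}. \<Sum>j\<in>{1..N} - {i}. weight G i j * interaction G X i j \<phi>)"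
    using cost_decomposition[OF assms] by (simp add: social_cost_def sum.distrib players_def)
  also have "(\<Sum>i\<in>{1..N}. \<Sum>j\<in>{1..N} - {i}. weight G i j * interaction G X i j \<phi>)
      = (\<Sum>(i, j)\<in>pairs. (weight G i j + weight G j i) * interaction G X i j \<phi>)"
    unfolding sum_ordered_pairs
    by (intro sum.cong refl)
      (auto simp: distrib_right interaction_commute[of "snd _"] intro: interaction_commute)
  finally show ?thesis .
qed

section \<open>The rescaled potential under unilateral deviations\<close>

definition balanced :: "(nat \<Rightarrow> real) \<Rightarrow> bool" where
  "balanced p \<longleftrightarrow> (\<forall>i\<in>players G. \<forall>j\<in>players G. p i * weight G i j = p j * weight G j i)"

text \<open>In the full double sum a deviation of player \<open>i\<close> affects exactly row
  \<open>i\<close> and column \<open>i\<close>, which is awkward to see when summing over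
  \<open>i < j\<close>.\<close>

lemma rescaled_potential_double_sum:
  "rescaled_potential G X p \<phi> = (\<Sum>i\<in>players G. p i * own_cost G X i \<phi>)
    + 1/2 * (\<Sum>i\<in>players G. \<Sum>j\<in>players G - {i}. p i * weight G i j * interaction G X i j \<phi>)"
proof -
  have "(\<Sum>(i, j)\<in>pairs. (p i * weight G i j + p j * weight G j i) * interaction G X i j \<phi>)
      = (\<Sum>i\<in>{1..N}. \<Sum>j\<in>{1..N} - {i}. p i * weight G i j * interaction G X i j \<phi>)"
    unfolding sum_ordered_pairs
    by (intro sum.cong refl) (auto simp: distrib_right intro: interaction_commute)
  then show ?thesis by (simp add: rescaled_potential_def players_def)
qed

text \<open>The balance condition makes the matrix \<open>D\<close> of weighted interaction changes
  symmetric. Only row \<open>i\<close> and column \<open>i\<close> are nonzero and they contribute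
  equally; this doubling cancels the factor \<open>1/2\<close>, and the weighted change of the
  deviator's own cost is left.\<close>

lemma rescaled_potential_unilateral:
  assumes bal: "balanced p" and \<phi>: "\<phi> \<in> profiles G" and i: "i \<in> players G" and \<psi>: "\<psi> \<in> policies G i"
  shows "rescaled_potential G X p (\<phi>(i := \<psi>)) - rescaled_potential G X p \<phi>
    = p i * (cost G X i (\<phi>(i := \<psi>)) - cost G X i \<phi>)"
proof -
  define \<phi>' where "\<phi>' = \<phi>(i := \<psi>)"
  have \<phi>': "\<phi>' \<in> profiles G"
    using \<phi> i \<psi> PiE_fun_upd[of \<psi> "policies G" i \<phi> "players G"]
    by (simp add: profiles_def \<phi>'_def insert_absorb)
  define C where "C k = own_cost G X k \<phi>' - own_cost G X k \<phi>" for k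
  define D where "D k l = p k * weight G k l * (interaction G X k l \<phi>' - interaction G X k l \<phi>)" for k l
  have C0: "C k = 0" if "k \<noteq> i" for k
    using that by (simp add: C_def own_cost_def \<phi>'_def)
  have D0: "D k l = 0" if "k \<noteq> i" "l \<noteq> i" for k l
    using that by (simp add: D_def interaction_def \<phi>'_def)
  have D_sym: "D k l = D l k" if "k \<in> players G" "l \<in> players G" for k l
    using bal that by (simp add: D_def balanced_def interaction_commute[of k])
  have C_sum: "(\<Sum>k\<in>players G. p k * C k) = p i * C i"
    using i C0 by (subst sum.remove[of _ i]) (auto intro!: sum.neutral)
  \<comment> \<open>A row \<open>k\<close> other than \<open>i\<close> contains only its entry in
    column \<open>i\<close>, which by symmetry belongs to row \<open>i\<close> as well.\<close>
  have row: "(\<Sum>l\<in>players G - {k}. D k l) = D i k" if "k \<in> players G - {i}" for k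
    using that i D0 D_sym[of i k]
    by (subst sum.remove[of _ i]) (auto intro!: sum.neutral)
  have D_sum: "(\<Sum>k\<in>players G. \<Sum>l\<in>players G - {k}. D k l) = 2 * (\<Sum>l\<in>players G - {i}. D i l)"
    using i row by (subst sum.remove[of _ i]) auto
  have "rescaled_potential G X p \<phi>' - rescaled_potential G X p \<phi>
      = (\<Sum>k\<in>players G. p k * C k) + 1/2 * (\<Sum>k\<in>players G. \<Sum>l\<in>players G - {k}. D k l)"
    unfolding rescaled_potential_double_sum C_def D_def
    by (simp add: right_diff_distrib sum_subtractf)
  also have "\<dots> = p i * C i + (\<Sum>l\<in>players G - {i}. D i l)"
    by (simp add: C_sum D_sum)
  also have "\<dots> = p i * (cost G X i \<phi>' - cost G X i \<phi>)"
    unfolding cost_decomposition[OF \<phi>' i] cost_decomposition[OF \<phi> i] C_def D_def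
    by (simp add: algebra_simps sum_subtractf sum_distrib_left)
  finally show ?thesis by (simp add: \<phi>'_def)
qed

lemma potential_minimizer_nash:
  assumes "balanced p" "\<forall>i\<in>players G. 0 < p i"
    and min: "is_arg_min (rescaled_potential G X p) (\<lambda>\<phi>. \<phi> \<in> profiles G) \<phi>"
  shows "\<phi> \<in> nash_equilibria G X"
proof -
  have \<phi>: "\<phi> \<in> profiles G" using min by (simp add: is_arg_min_def)
  have "cost G X i \<phi> \<le> cost G X i (\<phi>(i := \<psi>))" if i: "i \<in> players G" and \<psi>: "\<psi> \<in> policies G i" for i \<psi>
  proof -
    have "\<phi>(i := \<psi>) \<in> profiles G"
      using \<phi> i \<psi> PiE_fun_upd[of \<psi> "policies G" i \<phi> "players G"]
      by (simp add: profiles_def insert_absorb)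
    then have "0 \<le> rescaled_potential G X p (\<phi>(i := \<psi>)) - rescaled_potential G X p \<phi>"
      using min by (auto simp: is_arg_min_def not_less)
    then have "0 \<le> p i * (cost G X i (\<phi>(i := \<psi>)) - cost G X i \<phi>)"
      by (simp only: rescaled_potential_unilateral[OF assms(1) \<phi> i \<psi>])
    then show ?thesis using bspec[OF assms(2) i] by (simp add: zero_le_mult_iff)
  qed
  then show ?thesis using \<phi> by (simp add: nash_equilibria_def)
qed

end

section \<open>Comparison of the potential with the social cost\<close>

lemma harmonic_le_left:
  fixes a b :: real
  assumes "0 < a" "0 < b"
  shows "a * b / (a + b) \<le> a"
  using assms by (simp add: field_simps)

locale nonneg_game_states = game_states +
  assumes interacting: "\<exists>i\<in>players G. \<exists>j\<in>players G. i < j \<and> weight G i j + weight G j i > 0"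
    and own_nonneg: "\<forall>\<phi>\<in>profiles G. \<forall>i\<in>players G. 0 \<le> own_cost G X i \<phi>"
    and interaction_nonneg:
      "\<forall>\<phi>\<in>profiles G. \<forall>i\<in>players G. \<forall>j\<in>players G. i < j \<longrightarrow> 0 \<le> interaction G X i j \<phi>"
    and opt_pos: "0 < social_opt G X"
begin

lemma pairs_nonneg:
  assumes "\<phi> \<in> profiles G" "(i, j) \<in> pairs"
  shows "0 \<le> (weight G i j + weight G j i) * interaction G X i j \<phi>"
proof -
  have "i \<in> players G" "j \<in> players G" "i < j" using assms(2) by (auto simp: players_def)
  then show ?thesis
    using assms(1) interaction_nonneg weight_nonneg[of i j] weight_nonneg[of j i] by simp
qed

lemma social_cost_nonneg:
  assumes "\<phi> \<in> profiles G"
  shows "0 \<le> social_cost G X \<phi>"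
  unfolding social_cost_pairs[OF assms]
  using own_nonneg assms pairs_nonneg[OF assms]
  by (intro add_nonneg_nonneg sum_nonneg) auto

text \<open>An infimum in the reals lies below its members only if the set is bounded below; here 0
  is a lower bound, since social costs are nonnegative and the optimum is positive.\<close>

lemma price_of_stability_le:
  assumes "\<phi> \<in> nash_equilibria G X"
  shows "price_of_stability G X \<le> inefficiency G X \<phi>"
  unfolding price_of_stability_def
proof (rule cINF_lower[OF _ assms])
  show "bdd_below (inefficiency G X ` nash_equilibria G X)"
    using social_cost_nonneg opt_pos
    by (auto simp: inefficiency_def nash_equilibria_def intro!: bdd_belowI2[where m=0])
qed

context
  fixes p :: "nat \<Rightarrow> real"
  assumes p_pos: "\<forall>i\<in>players G. 0 < p i" and bal: "balanced p"
begin

text \<open>Each element is half the harmonic mean of two weights, and is the ratio between the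
  coefficients of an interaction in the potential and in the social cost.\<close>

definition "harmonic = {p i * p j / (p i + p j) | i j. i \<in> players G \<and> j \<in> players G \<and> i < j}"

lemma finite_harmonic: "finite harmonic"
proof (rule finite_subset)
  show "harmonic \<subseteq> (\<lambda>(i, j). p i * p j / (p i + p j)) ` (players G \<times> players G)"
    by (auto simp: harmonic_def)
qed simp

text \<open>\<open>Min\<close> is informative only on a nonempty set; the interacting pair provides
  an element.\<close>

lemma harmonic_nonempty: "harmonic \<noteq> {}"
  using interacting by (auto simp: harmonic_def)

lemma Min_harmonic_pos: "0 < Min harmonic"
  using finite_harmonic harmonic_nonempty p_pos
  by (auto simp: harmonic_def intro!: divide_pos_pos mult_pos_pos add_pos_pos)

text \<open>Controls the own-cost coefficients from below. Player \<open>i\<close> need not belong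
  to the interacting pair, but one of its two members differs from \<open>i\<close> and can act as
  partner.\<close>

lemma Min_harmonic_le:
  assumes "i \<in> players G"
  shows "Min harmonic \<le> p i"
proof -
  obtain k l where "k \<in> players G" "l \<in> players G" "k < l" using interacting by blast
  then obtain j where j: "j \<in> players G" "j \<noteq> i" by (metis less_irrefl)
  have "p i * p j / (p i + p j) \<in> harmonic"
  proof (cases "i < j")
    case False
    then have "p j * p i / (p j + p i) \<in> harmonic"
      using assms j unfolding harmonic_def by (intro CollectI exI[of _ j] exI[of _ i]) auto
    then show ?thesis by (simp add: mult.commute add.commute)
  qed (use assms j in \<open>auto simp: harmonic_def\<close>)
  then have "Min harmonic \<le> p i * p j / (p i + p j)"
    by (rule Min_le[OF finite_harmonic])
  also have "\<dots> \<le> p i" using assms j p_pos by (intro harmonic_le_left) auto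
  finally show ?thesis .
qed

lemma rescaled_potential_harmonic:
  "rescaled_potential G X p \<phi> = (\<Sum>i\<in>players G. p i * own_cost G X i \<phi>)
    + (\<Sum>(i, j)\<in>pairs. p i * p j / (p i + p j) *
        ((weight G i j + weight G j i) * interaction G X i j \<phi>))"
proof -
  have "1/2 * ((p i * weight G i j + p j * weight G j i) * interaction G X i j \<phi>)
      = p i * p j / (p i + p j) * ((weight G i j + weight G j i) * interaction G X i j \<phi>)"
    if "(i, j) \<in> pairs" for i j
  proof -
    have ij: "i \<in> players G" "j \<in> players G" using that by (auto simp: players_def)
    then have pos: "0 < p i" "0 < p j" using p_pos by auto
    have eq: "p i * weight G i j = p j * weight G j i"
      using bal ij by (simp add: balanced_def)
    have "p i * p j * (weight G i j + weight G j i)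
        = p j * (p i * weight G i j) + p i * (p j * weight G j i)"
      by (simp add: algebra_simps)
    also have "\<dots> = (p i + p j) * (p i * weight G i j)"
      by (simp only: eq[symmetric] distrib_right add.commute)
    finally have "p i * p j / (p i + p j) * (weight G i j + weight G j i) = p i * weight G i j"
      using pos by (simp add: field_simps)
    then show ?thesis
      unfolding mult.assoc[symmetric] by (simp add: eq)
  qed
  then show ?thesis
    unfolding rescaled_potential_def sum_distrib_left
    by (intro arg_cong2[of _ _ _ _ "(+)"] sum.cong refl) auto
qed

text \<open>The comparison is made coefficient by coefficient; nonnegativity of own costs and
  weighted interactions lets it pass to the sums.\<close>

lemma rescaled_potential_bounds:
  assumes \<phi>: "\<phi> \<in> profiles G"
  shows "Min harmonic * social_cost G X \<phi> \<le> rescaled_potential G X p \<phi>"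
    and "rescaled_potential G X p \<phi> \<le> Max (p ` players G) * social_cost G X \<phi>"
proof -
  have lower: "Min harmonic \<le> p i * p j / (p i + p j)"
    and upper: "p i * p j / (p i + p j) \<le> Max (p ` players G)" if "(i, j) \<in> pairs" for i j
  proof -
    have ij: "i \<in> players G" "j \<in> players G" "i < j" using that by (auto simp: players_def)
    then show "Min harmonic \<le> p i * p j / (p i + p j)"
      by (intro Min_le[OF finite_harmonic]) (auto simp: harmonic_def)
    have "p i * p j / (p i + p j) \<le> p i" using ij p_pos by (intro harmonic_le_left) auto
    also have "\<dots> \<le> Max (p ` players G)" using ij by simp
    finally show "p i * p j / (p i + p j) \<le> Max (p ` players G)" .
  qed
  show "Min harmonic * social_cost G X \<phi> \<le> rescaled_potential G X p \<phi>"
    unfolding social_cost_pairs[OF \<phi>] rescaled_potential_harmonic distrib_left sum_distrib_left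
    using own_nonneg \<phi> Min_harmonic_le lower pairs_nonneg[OF \<phi>]
    by (intro add_mono sum_mono) (auto intro!: mult_right_mono simp del: times_divide_eq_left)
  show "rescaled_potential G X p \<phi> \<le> Max (p ` players G) * social_cost G X \<phi>"
    unfolding social_cost_pairs[OF \<phi>] rescaled_potential_harmonic distrib_left sum_distrib_left
    using own_nonneg \<phi> upper pairs_nonneg[OF \<phi>]
    by (intro add_mono sum_mono) (auto intro!: mult_right_mono simp del: times_divide_eq_left)
qed

lemma inefficiency_minimizer_le:
  assumes min: "is_arg_min (rescaled_potential G X p) (\<lambda>\<phi>. \<phi> \<in> profiles G) \<phi>p"
  shows "inefficiency G X \<phi>p \<le> Max (p ` players G) / Min harmonic"
proof -
  let ?q = "Min harmonic" and ?m = "Max (p ` players G)"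
  obtain i where i: "i \<in> players G" using interacting by blast
  have "0 < p i" using i p_pos by simp
  also have "p i \<le> ?m" using i by simp
  finally have m: "0 < ?m" .
  have \<phi>p: "\<phi>p \<in> profiles G" using min by (simp add: is_arg_min_def)
  \<comment> \<open>Dividing by the largest weight turns the chain of inequalities into a lower
    bound on every social cost, which passes to the infimum whether or not it is attained.\<close>
  have "?q * social_cost G X \<phi>p / ?m \<le> social_opt G X"
    unfolding social_opt_def
  proof (rule cINF_greatest)
    fix \<phi> assume \<phi>: "\<phi> \<in> profiles G"
    have "?q * social_cost G X \<phi>p \<le> rescaled_potential G X p \<phi>p"
      by (rule rescaled_potential_bounds(1)[OF \<phi>p])
    also have "\<dots> \<le> rescaled_potential G X p \<phi>"
      using min \<phi> by (auto simp: is_arg_min_def not_less)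
    also have "\<dots> \<le> ?m * social_cost G X \<phi>"
      by (rule rescaled_potential_bounds(2)[OF \<phi>])
    finally show "?q * social_cost G X \<phi>p / ?m \<le> social_cost G X \<phi>"
      using m by (simp add: pos_divide_le_eq mult.commute)
  qed (use \<phi>p in blast)
  then show ?thesis
    using m opt_pos Min_harmonic_pos by (simp add: inefficiency_def field_simps)
qed

text \<open>The minimum of \<open>harmonic\<close> is attained at some pair, and twice its value is
  the harmonic mean of two weights, hence at least the smaller of them.\<close>

lemma Min_weights_le: "Min (p ` players G) \<le> 2 * Min harmonic"
proof -
  have "Min harmonic \<in> harmonic" by (rule Min_in[OF finite_harmonic harmonic_nonempty])
  then obtain i j where ij: "i \<in> players G" "j \<in> players G"
    and eq: "Min harmonic = p i * p j / (p i + p j)"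
    by (auto simp: harmonic_def)
  let ?l = "Min (p ` players G)"
  have le: "?l \<le> p i" "?l \<le> p j" and pos: "0 < p i" "0 < p j"
    using ij p_pos by auto
  have "?l * p i + ?l * p j \<le> p j * p i + p i * p j"
    using le pos by (intro add_mono mult_right_mono) auto
  then show ?thesis
    unfolding eq using pos by (simp add: field_simps)
qed

lemma weights_ratio_le:
  "Max (p ` players G) / Min harmonic \<le> 2 * (Max (p ` players G) / Min (p ` players G))"
proof -
  obtain i where i: "i \<in> players G" using interacting by blast
  have "0 < p i" using i p_pos by simp
  also have "p i \<le> Max (p ` players G)" using i by simp
  finally have m: "0 < Max (p ` players G)" .
  have l: "0 < Min (p ` players G)"
    using i p_pos by (subst Min_gr_iff) auto
  have "Max (p ` players G) * Min (p ` players G) \<le> Max (p ` players G) * (2 * Min harmonic)"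
    using m Min_weights_le by (intro mult_left_mono) auto
  then show ?thesis
    using l Min_harmonic_pos by (simp add: field_simps)
qed

end

end

theorem corollary4p8:
  fixes G :: "('w, 'd::finite, 'k::finite, 'm::finite) game"
    and X :: "('w, 'd, 'k) states"
    and p :: "nat \<Rightarrow> real"
  assumes game: "markov_game G"
    and states: "state_processes G X"
    and interacting: "\<exists>i\<in>players G. \<exists>j\<in>players G. i < j \<and> weight G i j + weight G j i > 0"
    and p_pos: "\<forall>i\<in>players G. 0 < p i"
    and balance: "\<forall>i\<in>players G. \<forall>j\<in>players G. p i * weight G i j = p j * weight G j i"
    and own_nonneg: "\<forall>\<phi>\<in>profiles G. \<forall>i\<in>players G. 0 \<le> own_cost G X i \<phi>"
    and interaction_nonneg:
      "\<forall>\<phi>\<in>profiles G. \<forall>i\<in>players G. \<forall>j\<in>players G. i < j \<longrightarrow> 0 \<le> interaction G X i j \<phi>"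
    and opt_pos: "0 < social_opt G X"
  shows
    "(\<forall>\<phi>p. is_arg_min (rescaled_potential G X p) (\<lambda>\<phi>. \<phi> \<in> profiles G) \<phi>p \<longrightarrow>
        price_of_stability G X \<le> inefficiency G X \<phi>p \<and>
        inefficiency G X \<phi>p
          \<le> Max (p ` players G)
             / Min {p i * p j / (p i + p j) | i j. i \<in> players G \<and> j \<in> players G \<and> i < j} \<and>
        Max (p ` players G)
             / Min {p i * p j / (p i + p j) | i j. i \<in> players G \<and> j \<in> players G \<and> i < j}
          \<le> 2 * (Max (p ` players G) / Min (p ` players G)))
     \<and> ((\<forall>i\<in>players G. \<forall>j\<in>players G. weight G i j = weight G j i) \<longrightarrow>
        (\<forall>\<phi>1. is_arg_min (rescaled_potential G X (\<lambda>_. 1)) (\<lambda>\<phi>. \<phi> \<in> profiles G) \<phi>1 \<longrightarrow>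
           price_of_stability G X \<le> inefficiency G X \<phi>1 \<and> inefficiency G X \<phi>1 \<le> 2))"
proof -
  interpret nonneg_game_states G X
    by unfold_locales fact+
  \<comment> \<open>Stated for arbitrary weights \<open>q\<close>, since it is applied both to
    \<open>p\<close> and to the constant weights 1.\<close>
  have bound: "price_of_stability G X \<le> inefficiency G X \<phi> \<and>
      inefficiency G X \<phi>
        \<le> Max (q ` players G)
           / Min {q i * q j / (q i + q j) | i j. i \<in> players G \<and> j \<in> players G \<and> i < j} \<and>
      Max (q ` players G)
           / Min {q i * q j / (q i + q j) | i j. i \<in> players G \<and> j \<in> players G \<and> i < j}
        \<le> 2 * (Max (q ` players G) / Min (q ` players G))"
    if q: "\<forall>i\<in>players G. 0 < q i" "balanced q"
      and min: "is_arg_min (rescaled_potential G X q) (\<lambda>\<phi>. \<phi> \<in> profiles G) \<phi>" for q \<phi>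
    using price_of_stability_le[OF potential_minimizer_nash[OF q(2,1) min]]
      inefficiency_minimizer_le[OF q min] weights_ratio_le[OF q]
    unfolding harmonic_def[OF q] by blast
  have "inefficiency G X \<phi>1 \<le> 2 \<and> price_of_stability G X \<le> inefficiency G X \<phi>1"
    if sym: "\<forall>i\<in>players G. \<forall>j\<in>players G. weight G i j = weight G j i"
      and min: "is_arg_min (rescaled_potential G X (\<lambda>_. 1)) (\<lambda>\<phi>. \<phi> \<in> profiles G) \<phi>1" for \<phi>1
  proof -
    \<comment> \<open>With unit weights, balance is the symmetry of \<open>weight G\<close>, and the
      largest and smallest weights coincide, so the last bound of the chain equals 2.\<close>
    have "(\<lambda>_. 1 :: real) ` players G = {1}" using interacting by auto
    then show ?thesis
      using bound[of "\<lambda>_. 1", OF _ _ min] sym by (auto simp: balanced_def)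
  qed
  moreover have "balanced p" using balance by (simp add: balanced_def)
  ultimately show ?thesis using bound[OF p_pos] by blast
qed

end
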